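(* Let $G$ be a graph, let ${\cal H}(G)$ be its injective hull, and let $\delta \ge 0$ be an integer or a half-integer. Then $hb(G)\le \delta$ if and only if ${\cal H}(G)$ contains - no isometric subgraph isomorphic to $H_2^{\delta}$, when $\delta$ is an integer; - neither an isometric subgraph isomorphic to $H_1^{\delta+\frac12}$ nor one isomorphic to $H_3^{\delta-\frac12}$, when $\delta$ is a half-integer.
   Context: All graphs are finite, connected, unweighted, undirected, without loops or multiple edges; $d(u,v)$ is the shortest-path distance. A subgraph $H$ of $G$ is isometric if it is induced and $d_H(u,v)=d_G(u,v)$ for all its vertices $u,v$. For four vertices $u,v,w,x$, $hb(u,v,w,x)$ is one half of the difference between the two largest of the sums $d(u,v)+d(w,x)$, $d(u,w)+d(v,x)$, $d(u,x)+d(v,w)$; the hyperbolicity $hb(G)$ is the maximum of $hb(u,v,w,x)$ over all quadruples. A graph is Helly if every family of pairwise intersecting disks $D(v,r)=\{u: d(u,v)\le r\}$ has a common vertex. The injective hull ${\cal H}(G)$ of $G$ is the smallest Helly graph into which $G$ embeds isometrically (it exists and is unique up to isomorphism, by Isbell and Dress). King-grid: the graph on $\mathbb{Z}^2$ in which distinct $(x,y),(x',y')$ are adjacent iff $\max(|x-x'|,|y-y'|)=1$. For $u=(x,y)$ let $s(u)=x+y$, $t(u)=x-y$. For non-negative integers $k,l$ define induced subgraphs of the King-grid: - $H_1^{k,l}$ induced by $\{u: 0\le s(u)\le 2k,\ 0\le t(u)\le 2l\}$, with corner points $a=(0,0)$, $b=(l,-l)$, $c=(k+l,k-l)$, $d=(k,k)$;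 - $H_2^{k,l}$ induced by $\{u: 0\le s(u)\le 2k+1,\ -1\le t(u)\le 2l\}\cup\{(-1,0),(k+l+1,k-l+1)\}$, with corner points $a=(-1,0)$, $b=(l,-l)$, $c=(k+l+1,k-l+1)$, $d=(k,k+1)$; - $H_3^{k,l}$ induced by $\{u: 0\le s(u)\le 2k+2,\ -1\le t(u)\le 2l+1\}\cup\{(l,-l-1),(-1,1),(k+1,k+2),(k+l+2,k-l)\}$, with corner points $a=(l,-l-1)$, $b=(-1,1)$, $c=(k+1,k+2)$, $d=(k+l+2,k-l)$. Write $H_i^k=H_i^{k,k}$. *)

theory Defs
  imports Complex_Main "Graph_Theory.Graph_Theory"
begin

text \<open>
  Undirected graphs are symmetric digraphs of the \<^locale>\<open>graph\<close> locale: finite, loopless,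
  without parallel arcs, every edge being represented by its two opposite arcs.
\<close>

definition conn_graph :: "('a, 'b) pre_digraph \<Rightarrow> bool" where
  "conn_graph G \<longleftrightarrow> graph G \<and> Digraph_Component.connected G"


subsection \<open>Shortest-path distance and isometric subgraphs\<close>

text \<open>If \<open>v\<close> is not reachable from \<open>u\<close>, the value is unspecified.\<close>

definition gdist :: "('a, 'b) pre_digraph \<Rightarrow> 'a \<Rightarrow> 'a \<Rightarrow> nat" where
  "gdist G u v = (LEAST n. \<exists>p. pre_digraph.awalk G u p v \<and> length p = n)"

lemma (in wf_digraph) mu_unit_eq_gdist:
  assumes "u \<rightarrow>\<^sup>*\<^bsub>G\<^esub> v"
  shows "\<mu> (\<lambda>_. 1) u v = ereal (real (gdist G u v))"
proof -
  have cost: "awalk_cost (\<lambda>_. 1) p = real (length p)" for p :: "'b awalk"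
    by (induct p) auto
  let ?P = "\<lambda>n. \<exists>p. awalk u p v \<and> length p = n"
  have "\<exists>n. ?P n"
    using assms by (auto simp: reachable_awalk)
  then have "?P (gdist G u v)"
    unfolding gdist_def by (rule LeastI_ex)
  then obtain p where p: "awalk u p v" "length p = gdist G u v"
    by blast
  have le: "gdist G u v \<le> length q" if "awalk u q v" for q
    unfolding gdist_def by (rule Least_le) (use that in blast)
  show ?thesis
    unfolding \<mu>_def cost
  proof (rule antisym)
    show "(INF q\<in>{q. awalk u q v}. ereal (real (length q))) \<le> ereal (real (gdist G u v))"
      using p by (metis (mono_tags, lifting) INF_lower mem_Collect_eq)
    show "ereal (real (gdist G u v)) \<le> (INF q\<in>{q. awalk u q v}. ereal (real (length q)))"
      by (rule INF_greatest) (simp add: le)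
  qed
qed

text \<open>
  Connectedness of \<open>H\<close> is required explicitly, because \<^const>\<open>gdist\<close> \<open>H u v\<close> is meaningful only
  if \<open>v\<close> is reachable from \<open>u\<close> in \<open>H\<close>.
\<close>

definition isometric_subgraph :: "('a, 'b) pre_digraph \<Rightarrow> ('a, 'b) pre_digraph \<Rightarrow> bool" where
  "isometric_subgraph H G \<longleftrightarrow>
     induced_subgraph H G \<and> Digraph_Component.connected H \<and>
     (\<forall>u\<in>verts H. \<forall>v\<in>verts H. gdist H u v = gdist G u v)"

definition contains_isometric :: "('a, 'b) pre_digraph \<Rightarrow> ('c, 'd) pre_digraph \<Rightarrow> bool" where
  "contains_isometric G K \<longleftrightarrow> (\<exists>H. isometric_subgraph H G \<and> digraph_iso H K)"

definition embeds_isometrically :: "('a, 'b) pre_digraph \<Rightarrow> ('c, 'd) pre_digraph \<Rightarrow> bool" where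
  "embeds_isometrically G H \<longleftrightarrow>
     (\<exists>f. f ` verts G \<subseteq> verts H \<and>
          (\<forall>u\<in>verts G. \<forall>v\<in>verts G. gdist H (f u) (f v) = gdist G u v))"


subsection \<open>Hyperbolicity\<close>

definition hb4 :: "('a, 'b) pre_digraph \<Rightarrow> 'a \<Rightarrow> 'a \<Rightarrow> 'a \<Rightarrow> 'a \<Rightarrow> real" where
  "hb4 G u v w x =
     (let s = sort [gdist G u v + gdist G w x, gdist G u w + gdist G v x, gdist G u x + gdist G v w]
      in (real (s ! 2) - real (s ! 1)) / 2)"

definition hb :: "('a, 'b) pre_digraph \<Rightarrow> real" where
  "hb G = Max {hb4 G u v w x | u v w x.
                 u \<in> verts G \<and> v \<in> verts G \<and> w \<in> verts G \<and> x \<in> verts G}"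


subsection \<open>Helly graphs and injective hulls\<close>

definition disk :: "('a, 'b) pre_digraph \<Rightarrow> 'a \<Rightarrow> nat \<Rightarrow> 'a set" where
  "disk G v r = {u \<in> verts G. gdist G u v \<le> r}"

definition helly_graph :: "('a, 'b) pre_digraph \<Rightarrow> bool" where
  "helly_graph G \<longleftrightarrow> conn_graph G \<and>
     (\<forall>F \<subseteq> {disk G v r | v r. v \<in> verts G}.
        (\<forall>A\<in>F. \<forall>B\<in>F. A \<inter> B \<noteq> {}) \<longrightarrow> (\<exists>x\<in>verts G. \<forall>A\<in>F. x \<in> A))"

text \<open>
  ``Smallest'' refers to isometric embeddability: a smallest Helly graph embeds isometrically into
  every Helly graph that admits an isometric embedding of \<open>G\<close>. Since graphs are finite and have no
  parallel arcs, each of them is isomorphic to one with natural numbers as vertices and pairs of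
  them as arcs, so letting \<open>K\<close> range over these is no restriction.
\<close>

definition is_injective_hull :: "('a, 'b) pre_digraph \<Rightarrow> ('c, 'd) pre_digraph \<Rightarrow> bool" where
  "is_injective_hull G H \<longleftrightarrow>
     helly_graph H \<and> embeds_isometrically G H \<and>
     (\<forall>K :: nat pair_pre_digraph.
        helly_graph K \<and> embeds_isometrically G K \<longrightarrow> embeds_isometrically H K)"


subsection \<open>The subgraphs of the King-grid\<close>

definition king_grid :: "(int \<times> int) pair_pre_digraph" where
  "king_grid =
     \<lparr> pverts = UNIV,
       parcs = {((x, y), (x', y')). max \<bar>x - x'\<bar> \<bar>y - y'\<bar> = 1} \<rparr>"

definition H1 :: "nat \<Rightarrow> nat \<Rightarrow> (int \<times> int, (int \<times> int) \<times> (int \<times> int)) pre_digraph" where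
  "H1 k l = king_grid \<restriction>
     {(x, y). 0 \<le> x + y \<and> x + y \<le> 2 * int k \<and> 0 \<le> x - y \<and> x - y \<le> 2 * int l}"

definition H2 :: "nat \<Rightarrow> nat \<Rightarrow> (int \<times> int, (int \<times> int) \<times> (int \<times> int)) pre_digraph" where
  "H2 k l = king_grid \<restriction>
     ({(x, y). 0 \<le> x + y \<and> x + y \<le> 2 * int k + 1 \<and> -1 \<le> x - y \<and> x - y \<le> 2 * int l} \<union>
      {(-1, 0), (int k + int l + 1, int k - int l + 1)})"

definition H3 :: "nat \<Rightarrow> nat \<Rightarrow> (int \<times> int, (int \<times> int) \<times> (int \<times> int)) pre_digraph" where
  "H3 k l = king_grid \<restriction>
     ({(x, y). 0 \<le> x + y \<and> x + y \<le> 2 * int k + 2 \<and> -1 \<le> x - y \<and> x - y \<le> 2 * int l + 1} \<union>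
      {(int l, - int l - 1), (-1, 1), (int k + 1, int k + 2), (int k + int l + 2, int k - int l)})"

end

theory Submission
  imports Defs
begin

text \<open>
  In the injective hull every geodesic from a vertex \<open>x\<close> to a vertex \<open>y\<close> can be prolonged beyond \<open>y\<close>
  to a vertex of \<open>G\<close>; prolonging never decreases the excess of a quadruple, so \<open>G\<close> and its hull have
  the same hyperbolicity. In a Helly graph, let \<open>a\<close>, \<open>b\<close>, \<open>c\<close>, \<open>d\<close> be four vertices for which
  \<open>d(a,c) + d(b,d)\<close> exceeds both other sums by at least \<open>m\<close>. A region of the King-grid with diagonals
  about \<open>m\<close> and sides about \<open>m / 2\<close> is attached to them by four tails of integer length; parity
  decides which of the three kinds of region fits. The Helly property extends the inclusion of the four
  vertices to a nonexpansive map of the region, and this map is isometric since any two points of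
  the region lie on a common geodesic between two corners. Conversely, the corners of an isometric copy
  form a quadruple of hyperbolicity greater than \<open>\<delta>\<close>.
\<close>

section \<open>Discrete geodesic metrics and distances in graphs\<close>

text \<open>The obstacle is integrality. The fit is governed by \<open>S\<close> and
  \<open>D\<close>, the sum and the difference of the tails at \<open>b\<close> and
  \<open>a\<close>. Each ranges over an integer interval; its length is the amount by which d(a,c) +
  d(b,d), less one of the other two sums, exceeds the same quantity for the region. A large enough
  excess makes both intervals nonempty, but the tails are integers only if \<open>S + D\<close> is
  even. One unit of slack in either interval cures a wrong parity. If both intervals are single
  points, a region with the same excess and the opposite parity must take over. For excess 2k+1 this
  is \<open>H2\<close> again, turned by a quarter, since its diagonals 2k+2 and 2k+1 differ. For
  excess 2k the diagonals of \<open>H1\<close> are equal, turning does not alter the parity, and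
  \<open>H3\<close> steps in. Hence one obstruction for integers and two for half-integers.\<close>

locale geodesic_metric =
  fixes W :: "'a set" and D :: "'a \<Rightarrow> 'a \<Rightarrow> nat"
  assumes zero_iff: "u \<in> W \<Longrightarrow> v \<in> W \<Longrightarrow> D u v = 0 \<longleftrightarrow> u = v"
    and sym: "u \<in> W \<Longrightarrow> v \<in> W \<Longrightarrow> D u v = D v u"
    and triangle: "u \<in> W \<Longrightarrow> v \<in> W \<Longrightarrow> w \<in> W \<Longrightarrow> D u w \<le> D u v + D v w"
    and strictly_between: "u \<in> W \<Longrightarrow> v \<in> W \<Longrightarrow> 2 \<le> D u v \<Longrightarrow>
      \<exists>w\<in>W. w \<noteq> u \<and> w \<noteq> v \<and> D u w + D w v = D u v"
begin

text \<open>Split at one interior point and recurse into the part that contains position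
  \<open>k\<close>. So \<open>strictly_between\<close> may ask for any interior point instead of a
  neighbour, which is easier to verify for subsets of graphs and of the grid.\<close>

lemma between_at:
  assumes "u \<in> W" "v \<in> W" "k \<le> D u v"
  shows "\<exists>w\<in>W. D u w = k \<and> D w v = D u v - k"
  using assms
proof (induction "D u v" arbitrary: u v k rule: less_induct)
  case less
  show ?case
  proof (cases "D u v \<ge> 2")
    case False
    with less.prems have "k = 0 \<or> k = D u v" by auto
    then show ?thesis using less.prems zero_iff by auto
  next
    case True
    then obtain w where w: "w \<in> W" "w \<noteq> u" "w \<noteq> v" "D u w + D w v = D u v"
      using strictly_between less.prems by blast
    have pos: "D u w > 0" "D w v > 0"
      using w zero_iff less.prems by (metis neq0_conv)+
    show ?thesis
    proof (cases "k \<le> D u w")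
      case True
      have "D u w < D u v" using w pos by linarith
      from less.hyps[OF this less.prems(1) w(1) True]
      obtain z where z: "z \<in> W" "D u z = k" "D z w = D u w - k" by blast
      have "D z v \<le> D z w + D w v" "D u v \<le> D u z + D z v"
        using triangle z w less.prems by blast+
      then show ?thesis using z w True by (intro bexI[of _ z]) auto
    next
      case False
      have "D w v < D u v" using w pos by linarith
      moreover have "k - D u w \<le> D w v" using less.prems w by linarith
      ultimately obtain z where z: "z \<in> W" "D w z = k - D u w" "D z v = D w v - (k - D u w)"
        using less.hyps w(1) less.prems(2) by blast
      have "D u z \<le> D u w + D w z" "D u v \<le> D u z + D z v"
        using triangle z w less.prems by blast+
      then show ?thesis using z w False less.prems by (intro bexI[of _ z]) auto
    qed
  qed
qed

end

lemma (in wf_digraph) dist_le_length_awalk: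
  assumes "geodesic_metric (verts G) D"
    and adj: "\<And>u v. u \<in> verts G \<Longrightarrow> v \<in> verts G \<Longrightarrow> (u, v) \<in> arcs_ends G \<longleftrightarrow> D u v = 1"
    and "awalk u p v"
  shows "D u v \<le> length p"
  using assms(3)
proof (induction p arbitrary: u)
  interpret geodesic_metric "verts G" D by fact
  {
    case Nil
    then show ?case using zero_iff by (auto simp: awalk_Nil_iff)
  next
    case (Cons e p)
    then have e: "e \<in> arcs G" "u = tail G e" "awalk (head G e) p v"
      by (auto simp: awalk_Cons_iff)
    have "D u (head G e) = 1"
      using adj[of u "head G e"] e by (auto simp: arcs_ends_conv)
    moreover have "D u v \<le> D u (head G e) + D (head G e) v"
      using e awalk_last_in_verts by (auto intro: triangle)
    ultimately show ?case using Cons.IH[OF e(3)] by simp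
  }
qed

lemma (in wf_digraph) awalk_of_dist:
  assumes "geodesic_metric (verts G) D"
    and adj: "\<And>u v. u \<in> verts G \<Longrightarrow> v \<in> verts G \<Longrightarrow> (u, v) \<in> arcs_ends G \<longleftrightarrow> D u v = 1"
    and "u \<in> verts G" "v \<in> verts G"
  shows "\<exists>p. awalk u p v \<and> length p = D u v"
  using assms(3)
proof (induction "D u v" arbitrary: u)
  interpret geodesic_metric "verts G" D by fact
  {
    case 0
    then show ?case using zero_iff assms(4) by (intro exI[of _ "[]"]) (auto simp: awalk_Nil_iff)
  next
    case (Suc n)
    then obtain w where w: "w \<in> verts G" "D u w = 1" "D w v = n"
      using between_at[of u v 1] assms(4) by auto
    then have "(u, w) \<in> arcs_ends G" using adj Suc.prems by blast
    then obtain e where "e \<in> arcs G" "tail G e = u" "head G e = w"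
      by (auto simp: arcs_ends_conv)
    moreover obtain p where "awalk w p v" "length p = n"
      using Suc.hyps(1) w by metis
    ultimately show ?case using Suc.hyps(2)
      by (intro exI[of _ "e # p"]) (auto simp: awalk_Cons_iff)
  }
qed

text \<open>Lets distances in induced subgraphs, copies and grid regions be read off from a formula,
  so that the later sections handle no walks.\<close>

lemma (in wf_digraph) gdist_eq_geodesic_metric:
  assumes "geodesic_metric (verts G) D"
    and "\<And>u v. u \<in> verts G \<Longrightarrow> v \<in> verts G \<Longrightarrow> (u, v) \<in> arcs_ends G \<longleftrightarrow> D u v = 1"
    and "u \<in> verts G" "v \<in> verts G"
  shows "gdist G u v = D u v"
  unfolding gdist_def
proof (rule Least_equality)
  show "\<exists>p. awalk u p v \<and> length p = D u v"
    by (rule awalk_of_dist[OF assms])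
  show "D u v \<le> n" if "\<exists>p. awalk u p v \<and> length p = n" for n
    using dist_le_length_awalk[OF assms(1,2)] that by blast
qed

lemma (in wf_digraph) connected_of_geodesic_metric:
  assumes "geodesic_metric (verts G) D"
    and "\<And>u v. u \<in> verts G \<Longrightarrow> v \<in> verts G \<Longrightarrow> (u, v) \<in> arcs_ends G \<longleftrightarrow> D u v = 1"
    and "verts G \<noteq> {}"
  shows "connected G"
  unfolding connected_def strongly_connected_def
proof (intro conjI ballI)
  show "verts (mk_symmetric G) \<noteq> {}" using assms(3) by (simp add: mk_symmetric_def)
  fix u v assume "u \<in> verts (mk_symmetric G)" "v \<in> verts (mk_symmetric G)"
  then have "u \<in> verts G" "v \<in> verts G" by (auto simp: mk_symmetric_def)
  from awalk_of_dist[OF assms(1,2) this] have "u \<rightarrow>\<^sup>*\<^bsub>G\<^esub> v"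
    unfolding reachable_awalk by blast
  then show "u \<rightarrow>\<^sup>*\<^bsub>mk_symmetric G\<^esub> v" by (rule reachable_mk_symmetricI)
qed

lemma (in sym_digraph) awalk_reverse:
  assumes "awalk u p v"
  shows "\<exists>q. awalk v q u \<and> length q = length p"
  using assms
proof (induction p arbitrary: u)
  case Nil
  then show ?case by (intro exI[of _ "[]"]) (auto simp: awalk_Nil_iff)
next
  case (Cons e p)
  then have e: "e \<in> arcs G" "u = tail G e" "awalk (head G e) p v"
    by (auto simp: awalk_Cons_iff)
  obtain q where q: "awalk v q (head G e)" "length q = length p"
    using Cons.IH[OF e(3)] by blast
  obtain e' where "e' \<in> arcs G" "tail G e' = head G e" "head G e' = tail G e"
    using sym_arcs e(1) unfolding symmetric_conv by metis
  then have "awalk (head G e) [e'] u"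
    using arc_implies_awalk e(2) by metis
  then have "awalk v (q @ [e']) u" using q(1) awalk_appendI by blast
  then show ?case using q(2) by (intro exI[of _ "q @ [e']"]) simp
qed

locale connected_graph = graph +
  assumes is_connected: "connected G"
begin

lemma gdist_awalk:
  assumes "u \<in> verts G" "v \<in> verts G"
  obtains p where "awalk u p v" "length p = gdist G u v"
proof -
  have "strongly_connected G"
    using symmetric_connected_imp_strongly_connected is_connected sym_arcs by blast
  then have "u \<rightarrow>\<^sup>*\<^bsub>G\<^esub> v" using assms by auto
  then have "\<exists>n p. awalk u p v \<and> length p = n"
    by (auto simp: reachable_awalk)
  then have "\<exists>p. awalk u p v \<and> length p = gdist G u v"
    unfolding gdist_def by (rule LeastI_ex)
  then show ?thesis using that by blast
qed

lemma gdist_le_length: "awalk u p v \<Longrightarrow> gdist G u v \<le> length p"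
  unfolding gdist_def by (rule Least_le) blast

lemma gdist_eq_0D:
  assumes "u \<in> verts G" "v \<in> verts G" "gdist G u v = 0"
  shows "u = v"
proof -
  obtain p where "awalk u p v" "length p = gdist G u v" using gdist_awalk[OF assms(1,2)] .
  then show ?thesis using assms(3) by (auto simp: awalk_Nil_iff)
qed

lemma arcs_ends_iff_gdist:
  assumes "u \<in> verts G" "v \<in> verts G"
  shows "(u, v) \<in> arcs_ends G \<longleftrightarrow> gdist G u v = 1"
proof
  assume "(u, v) \<in> arcs_ends G"
  then obtain e where e: "e \<in> arcs G" "u = tail G e" "v = head G e"
    by (auto simp: arcs_ends_conv)
  then have "gdist G u v \<le> 1"
    using gdist_le_length[OF arc_implies_awalk[OF e(1)]] by simp
  moreover have "u \<noteq> v" using e no_loops by blast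
  then have "gdist G u v \<noteq> 0"
    using gdist_eq_0D[OF assms] by blast
  ultimately show "gdist G u v = 1" by simp
next
  assume "gdist G u v = 1"
  moreover obtain p where "awalk u p v" "length p = gdist G u v"
    using gdist_awalk[OF assms] .
  ultimately obtain e where "awalk u [e] v" by (auto simp: length_Suc_conv)
  then show "(u, v) \<in> arcs_ends G"
    by (auto simp: awalk_Cons_iff awalk_Nil_iff arcs_ends_conv)
qed

sublocale geodesic_metric "verts G" "gdist G"
proof
  show tri: "gdist G u w \<le> gdist G u v + gdist G v w"
    if "u \<in> verts G" "v \<in> verts G" "w \<in> verts G" for u v w
  proof -
    obtain p where p: "awalk u p v" "length p = gdist G u v"
      using gdist_awalk[OF \<open>u \<in> verts G\<close> \<open>v \<in> verts G\<close>] .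
    obtain q where q: "awalk v q w" "length q = gdist G v w"
      using gdist_awalk[OF \<open>v \<in> verts G\<close> \<open>w \<in> verts G\<close>] .
    show ?thesis using gdist_le_length[OF awalk_appendI[OF p(1) q(1)]] p(2) q(2) by simp
  qed
  show zero: "gdist G u v = 0 \<longleftrightarrow> u = v" if "u \<in> verts G" "v \<in> verts G" for u v
  proof
    show "u = v" if "gdist G u v = 0"
      using gdist_eq_0D \<open>u \<in> verts G\<close> \<open>v \<in> verts G\<close> that by blast
    show "gdist G u v = 0" if "u = v"
      using gdist_le_length[of u "[]" v] that \<open>u \<in> verts G\<close> by (auto simp: awalk_Nil_iff)
  qed
  have le: "gdist G u v \<le> gdist G v u" if "u \<in> verts G" "v \<in> verts G" for u v
  proof -
    obtain p where p: "awalk v p u" "length p = gdist G v u"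
      using gdist_awalk[OF \<open>v \<in> verts G\<close> \<open>u \<in> verts G\<close>] .
    obtain q where "awalk u q v" "length q = length p" using awalk_reverse[OF p(1)] by blast
    then show ?thesis using gdist_le_length[of u q v] p(2) by simp
  qed
  show "gdist G u v = gdist G v u" if "u \<in> verts G" "v \<in> verts G" for u v
    by (rule antisym[OF le[OF that] le[OF that(2,1)]])
  fix u v assume uv: "u \<in> verts G" "v \<in> verts G" "2 \<le> gdist G u v"
  obtain p' where p': "awalk u p' v" "length p' = gdist G u v" using gdist_awalk[OF uv(1,2)] .
  with uv(3) obtain e p where "p' = e # p" by (cases p') auto
  with p' have e: "e \<in> arcs G" "tail G e = u" "awalk (head G e) p v" "Suc (length p) = gdist G u v"
    by (auto simp: awalk_Cons_iff)
  have 1: "gdist G u (head G e) \<le> 1"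
    using gdist_le_length[OF arc_implies_awalk[OF e(1)]] e(2) by simp
  have 2: "gdist G (head G e) v \<le> length p" using gdist_le_length e(3) by blast
  have 3: "gdist G u v \<le> gdist G u (head G e) + gdist G (head G e) v"
    by (rule tri[OF uv(1) head_in_verts[OF e(1)] uv(2)])
  have "gdist G u (head G e) \<noteq> 0" "gdist G (head G e) v \<noteq> 0"
    using 1 2 3 e(4) uv(3) by linarith+
  then have "head G e \<noteq> u" "head G e \<noteq> v"
    using zero[OF uv(1) head_in_verts[OF e(1)]] zero[OF head_in_verts[OF e(1)] uv(2)] by auto
  moreover have "gdist G u (head G e) + gdist G (head G e) v = gdist G u v"
    using 1 2 3 e(4) by linarith
  ultimately show "\<exists>w\<in>verts G. w \<noteq> u \<and> w \<noteq> v \<and> gdist G u w + gdist G w v = gdist G u v"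
    using head_in_verts[OF e(1)] by blast
qed

end

lemma connected_graph_iff: "connected_graph G \<longleftrightarrow> conn_graph G"
  by (simp add: connected_graph_def connected_graph_axioms_def conn_graph_def)

section \<open>Geodesic metrics realised as graphs, and their isometric copies\<close>

lemma geodesic_metric_transport:
  assumes "geodesic_metric W D" "bij_betw f Y W"
  shows "geodesic_metric Y (\<lambda>u v. D (f u) (f v))"
proof -
  interpret geodesic_metric W D by fact
  have img: "f u \<in> W" if "u \<in> Y" for u using that assms(2) by (auto simp: bij_betw_def)
  have inj: "f u = f v \<longleftrightarrow> u = v" if "u \<in> Y" "v \<in> Y" for u v
    using that assms(2) by (auto simp: bij_betw_def inj_on_eq_iff)
  show ?thesis
  proof
    fix u v assume uv: "u \<in> Y" "v \<in> Y" "2 \<le> D (f u) (f v)"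
    obtain w where w: "w \<in> W" "w \<noteq> f u" "w \<noteq> f v" "D (f u) w + D w (f v) = D (f u) (f v)"
      using strictly_between[OF img[OF uv(1)] img[OF uv(2)] uv(3)] by blast
    then obtain z where "z \<in> Y" "w = f z" using assms(2) by (auto simp: bij_betw_def)
    with w show "\<exists>w\<in>Y. w \<noteq> u \<and> w \<noteq> v \<and> D (f u) (f w) + D (f w) (f v) = D (f u) (f v)"
      by (intro bexI[of _ z]) auto
  qed (use img inj zero_iff sym triangle in auto)
qed

text \<open>One construction serves both the grid regions, with \<open>cheb\<close>, and the
  numbered copy of a hull with a vertex removed.\<close>

definition unit_graph :: "'a set \<Rightarrow> ('a \<Rightarrow> 'a \<Rightarrow> nat) \<Rightarrow> 'a pair_pre_digraph" where
  "unit_graph W D = \<lparr>pverts = W, parcs = {(u, v). u \<in> W \<and> v \<in> W \<and> D u v = 1}\<rparr>"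

lemma unit_graph_simps [simp]:
  "pverts (unit_graph W D) = W"
  "parcs (unit_graph W D) = {(u, v). u \<in> W \<and> v \<in> W \<and> D u v = 1}"
  by (simp_all add: unit_graph_def)

lemma wf_digraph_unit_graph: "wf_digraph (unit_graph W D)"
  by unfold_locales auto

context geodesic_metric
begin

lemma gdist_unit_graph:
  assumes "u \<in> W" "v \<in> W"
  shows "gdist (unit_graph W D) u v = D u v"
proof -
  interpret wf_digraph "unit_graph W D" by (rule wf_digraph_unit_graph)
  show ?thesis
    by (rule gdist_eq_geodesic_metric) (use assms geodesic_metric_axioms in auto)
qed

lemma connected_graph_unit_graph:
  assumes "finite W" "W \<noteq> {}"
  shows "connected_graph (unit_graph W D)"
proof -
  interpret wf_digraph "unit_graph W D" by (rule wf_digraph_unit_graph)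
  have "finite {(u, v). u \<in> W \<and> v \<in> W \<and> D u v = 1}"
    by (rule finite_subset[of _ "W \<times> W"]) (use assms in auto)
  moreover have "Digraph_Component.connected (unit_graph W D)"
    by (rule connected_of_geodesic_metric) (use assms geodesic_metric_axioms in auto)
  moreover have "u \<noteq> v" if "u \<in> W" "D u v = 1" for u v
    using that zero_iff[of u u] by auto
  ultimately show ?thesis
    using assms sym
    by unfold_locales (auto simp: symmetric_def sym_def arc_to_ends_def intro: symI)
qed

end

text \<open>Adjacency is distance one, so the graph induced on the image has the right arcs, and it
  is isometric because geodesics of \<open>W\<close> stay in it. The isomorphism names an arc by its
  pair of ends, which is injective as there are no parallel arcs.\<close>

lemma (in connected_graph) contains_isometric_unit_graphI:
  assumes "geodesic_metric W D" "W \<noteq> {}"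
    and phi: "\<phi> ` W \<subseteq> verts G" "\<And>u v. u \<in> W \<Longrightarrow> v \<in> W \<Longrightarrow> gdist G (\<phi> u) (\<phi> v) = D u v"
  shows "contains_isometric G (unit_graph W D)"
proof -
  interpret W: geodesic_metric W D by fact
  define H where "H = G \<restriction> (\<phi> ` W)"
  have ind: "induced_subgraph H G" unfolding H_def by (rule induced_induce[OF phi(1)])
  have vH [simp]: "verts H = \<phi> ` W" by (simp add: H_def)
  interpret H: wf_digraph H using ind by (rule wf_digraphI_induced)
  have inj: "inj_on \<phi> W"
  proof (rule inj_onI)
    fix u v assume uv: "u \<in> W" "v \<in> W" "\<phi> u = \<phi> v"
    then have "D u v = 0" using phi(2)[OF uv(1,2)] zero_iff[of "\<phi> u" "\<phi> v"] phi(1) by auto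
    then show "u = v" using W.zero_iff uv by blast
  qed
  define \<psi> where "\<psi> = inv_into W \<phi>"
  have psi: "\<psi> (\<phi> u) = u" if "u \<in> W" for u using that inj by (simp add: \<psi>_def)
  have bij: "bij_betw \<psi> (\<phi> ` W) W"
    unfolding \<psi>_def using inj by (simp add: bij_betw_inv_into inj_on_imp_bij_betw)
  have geo: "geodesic_metric (verts H) (\<lambda>u v. D (\<psi> u) (\<psi> v))"
    unfolding vH by (rule geodesic_metric_transport[OF assms(1) bij])
  have gd: "gdist G u v = D (\<psi> u) (\<psi> v)" if "u \<in> \<phi> ` W" "v \<in> \<phi> ` W" for u v
    using that phi(2) psi by auto
  have adj: "(u, v) \<in> arcs_ends H \<longleftrightarrow> D (\<psi> u) (\<psi> v) = 1" if "u \<in> verts H" "v \<in> verts H" for u v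
  proof -
    have "arcs H = {e \<in> arcs G. tail G e \<in> verts H \<and> head G e \<in> verts H}"
      "tail H = tail G" "head H = head G" by (simp_all add: H_def)
    then have "(u, v) \<in> arcs_ends H \<longleftrightarrow> (u, v) \<in> arcs_ends G"
      using that unfolding arcs_ends_conv by force
    then show ?thesis using arcs_ends_iff_gdist[of u v] gd[of u v] phi(1) that by auto
  qed
  have conn: "Digraph_Component.connected H"
    by (rule H.connected_of_geodesic_metric[OF geo adj]) (use assms(2) in auto)
  have "gdist H u v = gdist G u v" if "u \<in> verts H" "v \<in> verts H" for u v
    using H.gdist_eq_geodesic_metric[OF geo adj that] gd that by simp
  then have "isometric_subgraph H G"
    unfolding isometric_subgraph_def using ind conn by blast
  moreover have "digraph_iso H (unit_graph W D)"
  proof -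
    define f where "f = \<lparr>iso_verts = \<psi>, iso_arcs = (\<lambda>a. (\<psi> (tail H a), \<psi> (head H a))),
      iso_head = snd, iso_tail = fst\<rparr>"
    have injpsi: "inj_on \<psi> (\<phi> ` W)" using bij by (simp add: bij_betw_def)
    have th: "tail H a \<in> \<phi> ` W" "head H a \<in> \<phi> ` W" if "a \<in> arcs H" for a
      using H.wellformed[OF that] by auto
    have "inj_on (\<lambda>a. (\<psi> (tail H a), \<psi> (head H a))) (arcs H)"
    proof (rule inj_onI, clarsimp)
      fix a b assume ab: "a \<in> arcs H" "b \<in> arcs H"
        "\<psi> (tail H a) = \<psi> (tail H b)" "\<psi> (head H a) = \<psi> (head H b)"
      then have "tail H a = tail H b" "head H a = head H b"
        using th[OF ab(1)] th[OF ab(2)] by (simp_all add: inj_on_eq_iff[OF injpsi])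
      then show "a = b" using no_multi_arcs[of a b] ab by (simp add: H_def arc_to_ends_def)
    qed
    then have "H.digraph_isomorphism f"
      unfolding H.digraph_isomorphism_def using injpsi H.wf_digraph_axioms by (simp add: f_def)
    moreover have "with_proj (unit_graph W D) = app_iso f H"
    proof (rule pre_digraph.equality)
      show "verts (unit_graph W D) = verts (app_iso f H)"
        using bij by (simp add: f_def bij_betw_def)
      show "arcs (unit_graph W D) = arcs (app_iso f H)"
      proof (rule set_eqI)
        fix a :: "'c \<times> 'c"
        obtain u v where a: "a = (u, v)" by force
        have "a \<in> arcs (unit_graph W D) \<longleftrightarrow> u \<in> W \<and> v \<in> W \<and> (\<phi> u, \<phi> v) \<in> arcs_ends H"
          using adj[of "\<phi> u" "\<phi> v"] psi a by auto
        also have "\<dots> \<longleftrightarrow> a \<in> arcs (app_iso f H)"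
        proof
          assume uv: "u \<in> W \<and> v \<in> W \<and> (\<phi> u, \<phi> v) \<in> arcs_ends H"
          then obtain e where e: "e \<in> arcs H" "tail H e = \<phi> u" "head H e = \<phi> v"
            by (auto simp: arcs_ends_conv)
          then have "a = iso_arcs f e" using uv psi by (simp add: f_def a)
          then show "a \<in> arcs (app_iso f H)" using e(1) by simp
        next
          assume "a \<in> arcs (app_iso f H)"
          then obtain e where e: "e \<in> arcs H" "u = \<psi> (tail H e)" "v = \<psi> (head H e)"
            by (auto simp: f_def a)
          with th[OF e(1)] psi have "u \<in> W" "v \<in> W" "\<phi> u = tail H e" "\<phi> v = head H e" by auto
          then show "u \<in> W \<and> v \<in> W \<and> (\<phi> u, \<phi> v) \<in> arcs_ends H"
            using e(1) by (auto simp: arcs_ends_conv)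
        qed
        finally show "a \<in> arcs (unit_graph W D) \<longleftrightarrow> a \<in> arcs (app_iso f H)" .
      qed
    qed (simp_all add: f_def)
    ultimately show ?thesis unfolding digraph_iso_def by blast
  qed
  ultimately show ?thesis unfolding contains_isometric_def by blast
qed

lemma contains_isometric_unit_graphD:
  assumes "geodesic_metric W D" "contains_isometric G (unit_graph W D)"
  shows "\<exists>\<phi>. \<phi> ` W \<subseteq> verts G \<and> (\<forall>u\<in>W. \<forall>v\<in>W. gdist G (\<phi> u) (\<phi> v) = D u v)"
proof -
  interpret W: geodesic_metric W D by fact
  obtain H where iso: "isometric_subgraph H G" and "digraph_iso H (unit_graph W D)"
    using assms(2) unfolding contains_isometric_def by blast
  then obtain f where f: "pre_digraph.digraph_isomorphism H f" "with_proj (unit_graph W D) = app_iso f H"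
    unfolding digraph_iso_def by blast
  let ?g = "iso_verts f"
  interpret H: wf_digraph H using f(1) by (simp add: pre_digraph.digraph_isomorphism_def)
  have inj: "inj_on ?g (verts H)" using f(1) by (simp add: pre_digraph.digraph_isomorphism_def)
  have img: "?g ` verts H = W" using arg_cong[OF f(2), of verts] by simp
  have arcs: "iso_arcs f ` arcs H = {(u, v). u \<in> W \<and> v \<in> W \<and> D u v = 1}"
    using arg_cong[OF f(2), of arcs] by simp
  have "iso_tail f = fst" "iso_head f = snd"
    using arg_cong[OF f(2), of tail] arg_cong[OF f(2), of head] by simp_all
  then have ends: "iso_arcs f a = (?g (tail H a), ?g (head H a))" if "a \<in> arcs H" for a
    using f(1) that by (simp add: pre_digraph.digraph_isomorphism_def prod_eq_iff)
  have bij: "bij_betw ?g (verts H) W" using inj img by (simp add: bij_betw_def)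
  have adj: "(u, v) \<in> arcs_ends H \<longleftrightarrow> D (?g u) (?g v) = 1" if uv: "u \<in> verts H" "v \<in> verts H" for u v
  proof
    assume "(u, v) \<in> arcs_ends H"
    then obtain a where "a \<in> arcs H" "tail H a = u" "head H a = v" by (auto simp: arcs_ends_conv)
    then have "(?g u, ?g v) \<in> iso_arcs f ` arcs H" using ends by (metis imageI)
    then show "D (?g u) (?g v) = 1" using arcs by simp
  next
    assume "D (?g u) (?g v) = 1"
    then have "(?g u, ?g v) \<in> iso_arcs f ` arcs H" using arcs img uv by auto
    then obtain a where a: "a \<in> arcs H" "?g u = ?g (tail H a)" "?g v = ?g (head H a)"
      using ends by auto
    then have "u = tail H a" "v = head H a" using inj_onD[OF inj] uv H.wellformed by blast+
    then show "(u, v) \<in> arcs_ends H" using a(1) by (auto simp: arcs_ends_conv)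
  qed
  have gd: "gdist H u v = D (?g u) (?g v)" if "u \<in> verts H" "v \<in> verts H" for u v
    by (rule H.gdist_eq_geodesic_metric[OF geodesic_metric_transport[OF assms(1) bij] adj that])
  define \<phi> where "\<phi> = inv_into (verts H) ?g"
  have phi: "\<phi> u \<in> verts H" "?g (\<phi> u) = u" if "u \<in> W" for u
    using that img unfolding \<phi>_def by (auto simp: inv_into_into f_inv_into_f)
  have "verts H \<subseteq> verts G" using iso by (auto simp: isometric_subgraph_def induced_subgraph_def subgraph_def)
  then have "\<phi> ` W \<subseteq> verts G" using phi by blast
  moreover have "gdist G (\<phi> u) (\<phi> v) = D u v" if "u \<in> W" "v \<in> W" for u v
    using that phi gd[of "\<phi> u" "\<phi> v"] iso by (simp add: isometric_subgraph_def)
  ultimately show ?thesis by blast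
qed

section \<open>Hyperbolicity as a four-point inequality\<close>

text \<open>For the largest sum the inequality is the bound on the gap; for the other two it holds
  trivially. This form avoids deciding which sum is largest.\<close>

lemma top_gap_le_iff:
  fixes a b c n :: nat
  shows "(let s = sort [a, b, c] in (real (s ! 2) - real (s ! 1)) / 2) \<le> real n / 2 \<longleftrightarrow>
    a \<le> max b c + n \<and> b \<le> max a c + n \<and> c \<le> max a b + n"
  by (auto simp: Let_def max_def numeral_2_eq_2)

text \<open>One inequality suffices, since permuting the quadruple yields all three of
  \<open>top_gap_le_iff\<close>. The bound \<open>n / 2\<close> covers integers and half-integers at
  once.\<close>

lemma (in connected_graph) hb_le_iff:
  "hb G \<le> real n / 2 \<longleftrightarrow>
    (\<forall>u\<in>verts G. \<forall>v\<in>verts G. \<forall>w\<in>verts G. \<forall>x\<in>verts G.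
      gdist G u v + gdist G w x \<le> max (gdist G u w + gdist G v x) (gdist G u x + gdist G v w) + n)"
  (is "_ \<longleftrightarrow> ?R")
proof -
  let ?V = "verts G"
  let ?S = "{hb4 G u v w x | u v w x. u \<in> ?V \<and> v \<in> ?V \<and> w \<in> ?V \<and> x \<in> ?V}"
  have S: "?S = (\<lambda>(u, v, w, x). hb4 G u v w x) ` (?V \<times> ?V \<times> ?V \<times> ?V)"
    by (auto simp: image_def Bex_def)
  have "finite ?S" unfolding S by simp
  moreover have "?V \<noteq> {}" using is_connected by (auto simp: connected_def strongly_connected_def mk_symmetric_def)
  then have "?S \<noteq> {}" unfolding S by simp
  ultimately have "hb G \<le> real n / 2 \<longleftrightarrow> (\<forall>h\<in>?S. h \<le> real n / 2)"
    unfolding hb_def by (rule Max_le_iff)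
  also have "\<dots> \<longleftrightarrow> (\<forall>u\<in>?V. \<forall>v\<in>?V. \<forall>w\<in>?V. \<forall>x\<in>?V. hb4 G u v w x \<le> real n / 2)"
    by blast
  also have "\<dots> \<longleftrightarrow> ?R"
  proof (intro iffI ballI)
    fix u v w x assume "\<forall>u\<in>?V. \<forall>v\<in>?V. \<forall>w\<in>?V. \<forall>x\<in>?V. hb4 G u v w x \<le> real n / 2"
      and "u \<in> ?V" "v \<in> ?V" "w \<in> ?V" "x \<in> ?V"
    then show "gdist G u v + gdist G w x
        \<le> max (gdist G u w + gdist G v x) (gdist G u x + gdist G v w) + n"
      unfolding hb4_def top_gap_le_iff by blast
  next
    fix u v w x assume R: ?R and uvwx: "u \<in> ?V" "v \<in> ?V" "w \<in> ?V" "x \<in> ?V"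
    have s: "gdist G w v = gdist G v w" "gdist G x v = gdist G v x" "gdist G x w = gdist G w x"
      using sym uvwx by auto
    from R[rule_format, OF uvwx(1,2,3,4)] R[rule_format, OF uvwx(1,3,2,4)]
      R[rule_format, OF uvwx(1,4,2,3)]
    show "hb4 G u v w x \<le> real n / 2"
      unfolding hb4_def top_gap_le_iff s by (simp add: max.commute)
  qed
  finally show ?thesis .
qed

section \<open>Helly graphs\<close>

locale connected_helly_graph = connected_graph +
  assumes is_helly: "helly_graph G"
begin

text \<open>Two disks meet once the distance of their centres is at most the sum of the radii: the
  point of a geodesic at distance \<open>min r (gdist G v v')\<close> from \<open>v\<close> lies in
  both. The Helly property thus speaks of distances alone.\<close>

lemma helly_point:
  assumes verts: "\<And>v r. (v, r) \<in> C \<Longrightarrow> v \<in> verts G"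
    and near: "\<And>v r v' r'. (v, r) \<in> C \<Longrightarrow> (v', r') \<in> C \<Longrightarrow> gdist G v v' \<le> r + r'"
  shows "\<exists>x\<in>verts G. \<forall>(v, r)\<in>C. gdist G x v \<le> r"
proof -
  let ?F = "(\<lambda>(v, r). disk G v r) ` C"
  have "?F \<subseteq> {disk G v r | v r. v \<in> verts G}" using verts by auto
  moreover have "\<forall>A\<in>?F. \<forall>B\<in>?F. A \<inter> B \<noteq> {}"
  proof clarify
    fix v r v' r' assume C: "(v, r) \<in> C" "(v', r') \<in> C" and emp: "disk G v r \<inter> disk G v' r' = {}"
    have vs: "v \<in> verts G" "v' \<in> verts G" using verts C by blast+
    obtain w where w: "w \<in> verts G" "gdist G v w = min r (gdist G v v')"
      "gdist G w v' = gdist G v v' - min r (gdist G v v')"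
      using between_at[OF vs, of "min r (gdist G v v')"] by auto
    then have "w \<in> disk G v r \<inter> disk G v' r'"
      using near[OF C] sym[OF vs(1) w(1)] by (auto simp: disk_def)
    with emp show False by blast
  qed
  ultimately obtain x where "x \<in> verts G" "\<forall>A\<in>?F. x \<in> A"
    using is_helly unfolding helly_graph_def by meson
  then show ?thesis by (auto simp: disk_def)
qed

text \<open>The disk of radius \<open>gdist G x y - 1\<close> about \<open>x\<close> and the unit
  disks about all \<open>z\<close> in the closed neighbourhood of \<open>y\<close> meet pairwise: by
  \<open>far\<close> each \<open>z\<close> is within \<open>gdist G x y\<close> of \<open>x\<close>,
  and any two are joined through \<open>y\<close>. A common point dominates \<open>y\<close> and is
  nearer to \<open>x\<close>, hence is not \<open>y\<close>.\<close>

lemma dominated_if_farthest: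
  assumes "x \<in> verts G" "y \<in> verts G" "x \<noteq> y"
    and far: "\<And>z. z \<in> verts G \<Longrightarrow> gdist G y z = 1 \<Longrightarrow> gdist G x z \<le> gdist G x y"
  shows "\<exists>y'\<in>verts G - {y}. \<forall>z\<in>verts G. gdist G y z \<le> 1 \<longrightarrow> gdist G y' z \<le> 1"
proof -
  let ?n = "gdist G x y"
  have n: "?n \<noteq> 0" using zero_iff assms by blast
  let ?C = "insert (x, ?n - 1) {(z, 1) | z. z \<in> verts G \<and> gdist G y z \<le> 1}"
  have xz: "gdist G x z \<le> ?n" if "z \<in> verts G" "gdist G y z \<le> 1" for z
  proof (cases "gdist G y z = 0")
    case True
    then show ?thesis using zero_iff[OF assms(2) that(1)] by simp
  qed (use that far[of z] in auto)
  have zx: "gdist G z x \<le> ?n" if "z \<in> verts G" "gdist G y z \<le> 1" for z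
    using xz[OF that] sym[OF assms(1) that(1)] by simp
  have zz: "gdist G z z' \<le> 2" if "z \<in> verts G" "gdist G y z \<le> 1" "z' \<in> verts G" "gdist G y z' \<le> 1" for z z'
    using triangle[OF that(1) assms(2) that(3)] sym[OF that(1) assms(2)] that by simp
  have "gdist G x x = 0" using zero_iff assms(1) by blast
  then have "\<exists>y'\<in>verts G. \<forall>(v, r)\<in>?C. gdist G y' v \<le> r"
    using n assms(1) by (intro helly_point) (auto dest: xz zx zz)
  then obtain y' where y': "y' \<in> verts G" "gdist G y' x \<le> ?n - 1"
    "\<And>z. z \<in> verts G \<Longrightarrow> gdist G y z \<le> 1 \<Longrightarrow> gdist G y' z \<le> 1"
    by auto
  have "y' \<noteq> y" using y'(2) n sym[OF assms(1,2)] by auto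
  then show ?thesis using y' by blast
qed

end

lemma (in geodesic_metric) helly_unit_graph:
  assumes "finite W" "W \<noteq> {}"
    and point: "\<And>C. (\<And>v r. (v, r) \<in> C \<Longrightarrow> v \<in> W) \<Longrightarrow>
      (\<And>v r v' r'. (v, r) \<in> C \<Longrightarrow> (v', r') \<in> C \<Longrightarrow> D v v' \<le> r + r') \<Longrightarrow>
      \<exists>x\<in>W. \<forall>(v, r)\<in>C. D x v \<le> r"
  shows "helly_graph (unit_graph W D)"
proof -
  let ?K = "with_proj (unit_graph W D)"
  have disk: "disk ?K v r = {u \<in> W. D u v \<le> r}" if "v \<in> W" for v r
    using that gdist_unit_graph by (auto simp: disk_def)
  have "\<exists>x\<in>verts ?K. \<forall>A\<in>F. x \<in> A"
    if F: "F \<subseteq> {disk ?K v r | v r. v \<in> verts ?K}" "\<forall>A\<in>F. \<forall>B\<in>F. A \<inter> B \<noteq> {}" for F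
  proof -
    \<comment> \<open>A disk may have several centres and radii. Taking all of them is harmless, as
      the distance bound comes from the intersection of the sets.\<close>
    let ?C = "{(v, r). v \<in> W \<and> disk ?K v r \<in> F}"
    have "\<exists>x\<in>W. \<forall>(v, r)\<in>?C. D x v \<le> r"
    proof (rule point)
      fix v r v' r' assume C: "(v, r) \<in> ?C" "(v', r') \<in> ?C"
      then have "disk ?K v r \<inter> disk ?K v' r' \<noteq> {}" using F(2) by blast
      then obtain u where u: "u \<in> W" "D u v \<le> r" "D u v' \<le> r'" using C disk by auto
      then show "D v v' \<le> r + r'" using triangle[of v u v'] sym[of u v] C by auto
    qed auto
    then obtain x where x: "x \<in> W" "\<forall>(v, r)\<in>?C. D x v \<le> r" by blast
    have "x \<in> A" if "A \<in> F" for A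
    proof -
      obtain v r where "A = disk ?K v r" "v \<in> W" using F(1) \<open>A \<in> F\<close> by auto
      then show ?thesis using x disk \<open>A \<in> F\<close> by auto
    qed
    then show ?thesis using x(1) by auto
  qed
  then show ?thesis
    using connected_graph_unit_graph[OF assms(1,2)] unfolding helly_graph_def connected_graph_iff by blast
qed

section \<open>The hull is spanned by geodesics\<close>

context connected_helly_graph
begin

text \<open>This is the fold of \<open>y\<close> onto \<open>y'\<close> that fixes all else: the
  second vertex of a geodesic from \<open>y\<close> to \<open>v\<close> is a neighbour of
  \<open>y\<close>, so \<open>y'\<close> is within one step of it.\<close>

lemma retraction_nonexpansive:
  assumes y: "y \<in> verts G" and y': "y' \<in> verts G"
    and dom: "\<And>z. z \<in> verts G \<Longrightarrow> gdist G y z \<le> 1 \<Longrightarrow> gdist G y' z \<le> 1"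
    and v: "v \<in> verts G" "v \<noteq> y"
  shows "gdist G y' v \<le> gdist G y v"
proof -
  have "1 \<le> gdist G y v" using zero_iff[OF y v(1)] v(2) by (simp add: Suc_le_eq)
  from between_at[OF y v(1) this] obtain z
    where z: "z \<in> verts G" "gdist G y z = 1" "gdist G z v = gdist G y v - 1" by blast
  then have "gdist G y' v \<le> 1 + (gdist G y v - 1)"
    using triangle[OF y' z(1) v(1)] dom[OF z(1)] by simp
  then show ?thesis using \<open>1 \<le> gdist G y v\<close> by simp
qed

text \<open>An interior point \<open>y\<close> is replaced by \<open>y'\<close>: folding increases
  neither distance to the ends and the triangle inequality forbids a smaller sum, so both are kept.
  Deleting \<open>y\<close> therefore changes no other distance.\<close>

lemma geodesic_metric_remove_dominated:
  assumes y: "y \<in> verts G" and y': "y' \<in> verts G - {y}"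
    and dom: "\<And>z. z \<in> verts G \<Longrightarrow> gdist G y z \<le> 1 \<Longrightarrow> gdist G y' z \<le> 1"
  shows "geodesic_metric (verts G - {y}) (gdist G)"
proof
  fix u v assume uv: "u \<in> verts G - {y}" "v \<in> verts G - {y}" "2 \<le> gdist G u v"
  then have V: "u \<in> verts G" "v \<in> verts G" "y' \<in> verts G" using y' by auto
  obtain w where w: "w \<in> verts G" "w \<noteq> u" "w \<noteq> v" "gdist G u w + gdist G w v = gdist G u v"
    using strictly_between[OF V(1,2) uv(3)] by blast
  show "\<exists>w\<in>verts G - {y}. w \<noteq> u \<and> w \<noteq> v \<and> gdist G u w + gdist G w v = gdist G u v"
  proof (cases "w = y")
    case False
    then show ?thesis using w by blast
  next
    case True
    have pos: "gdist G u y \<noteq> 0" "gdist G y v \<noteq> 0"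
      using w True zero_iff[OF V(1) y] zero_iff[OF y V(2)] by auto
    have "gdist G y' u \<le> gdist G y u" "gdist G y' v \<le> gdist G y v"
      using retraction_nonexpansive[OF y V(3) dom] uv by auto
    then have le: "gdist G u y' \<le> gdist G u y" "gdist G y' v \<le> gdist G y v"
      using sym[OF V(1) V(3)] sym[OF V(1) y] by simp_all
    with triangle[OF V(1) V(3) V(2)] w True
    have eq: "gdist G u y' = gdist G u y" "gdist G y' v = gdist G y v" by auto
    then have "y' \<noteq> u" "y' \<noteq> v"
      using pos zero_iff[OF V(1) V(3)] zero_iff[OF V(3) V(2)] by auto
    then show ?thesis using eq w True y' by (intro bexI[of _ y']) auto
  qed
qed (use zero_iff sym triangle in auto)

text \<open>The vertices are numbered because \<open>is_injective_hull\<close> compares the hull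
  with graphs on \<open>nat\<close>.\<close>

lemma helly_nat_copy_remove_dominated:
  assumes y: "y \<in> verts G" and y': "y' \<in> verts G - {y}"
    and dom: "\<And>z. z \<in> verts G \<Longrightarrow> gdist G y z \<le> 1 \<Longrightarrow> gdist G y' z \<le> 1"
  obtains K :: "nat pair_pre_digraph" and e
  where "helly_graph K" "bij_betw e (verts G - {y}) (verts K)"
    "\<And>u v. u \<in> verts G - {y} \<Longrightarrow> v \<in> verts G - {y} \<Longrightarrow> gdist K (e u) (e v) = gdist G u v"
proof -
  let ?W = "verts G - {y}"
  have fin: "finite ?W" by simp
  obtain e :: "'a \<Rightarrow> nat" where inj: "inj_on e ?W"
    using finite_imp_inj_to_nat_seg[OF fin] by blast
  define g where "g = inv_into ?W e"
  have g: "g (e u) = u" if "u \<in> ?W" for u using that inj by (simp add: g_def)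
  have bij: "bij_betw g (e ` ?W) ?W"
    unfolding g_def using inj by (simp add: bij_betw_inv_into inj_on_imp_bij_betw)
  let ?D = "\<lambda>u v. gdist G (g u) (g v)"
  interpret K: geodesic_metric "e ` ?W" ?D
    by (rule geodesic_metric_transport[OF geodesic_metric_remove_dominated[OF assms] bij])
  have "helly_graph (unit_graph (e ` ?W) ?D)"
  proof (rule K.helly_unit_graph)
    show "finite (e ` ?W)" "e ` ?W \<noteq> {}" using y' by auto
    fix C assume C: "\<And>v r. (v, r) \<in> C \<Longrightarrow> v \<in> e ` ?W"
      "\<And>v r v' r'. (v, r) \<in> C \<Longrightarrow> (v', r') \<in> C \<Longrightarrow> ?D v v' \<le> r + r'"
    let ?C = "(\<lambda>(v, r). (g v, r)) ` C"
    have gW: "g v \<in> ?W" if "(v, r) \<in> C" for v r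
      using C(1)[OF that] bij by (auto simp: bij_betw_def)
    then have "\<exists>x\<in>verts G. \<forall>(v, r)\<in>?C. gdist G x v \<le> r"
      using C(2) by (intro helly_point) auto
    then obtain x where x: "x \<in> verts G" "\<And>v r. (v, r) \<in> C \<Longrightarrow> gdist G x (g v) \<le> r" by fast
    \<comment> \<open>If the Helly point of the whole graph is the deleted vertex, it is folded onto
      \<open>y'\<close>. All radii survive because no disk is centred at \<open>y\<close>.\<close>
    define x' where "x' = (if x = y then y' else x)"
    have x': "x' \<in> ?W" using x(1) y' by (auto simp: x'_def)
    have "gdist G x' (g v) \<le> r" if "(v, r) \<in> C" for v r
    proof -
      have "gdist G x' (g v) \<le> gdist G x (g v)"
        using retraction_nonexpansive[OF y _ dom] y' gW[OF that] by (auto simp: x'_def)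
      then show ?thesis using x(2)[OF that] by simp
    qed
    then show "\<exists>x\<in>e ` ?W. \<forall>(v, r)\<in>C. ?D x v \<le> r"
      using x' g by (intro bexI[of _ "e x'"]) auto
  qed
  moreover have "bij_betw e ?W (verts (unit_graph (e ` ?W) ?D))"
    using inj by (simp add: bij_betw_def)
  moreover have "gdist (unit_graph (e ` ?W) ?D) (e u) (e v) = gdist G u v"
    if "u \<in> ?W" "v \<in> ?W" for u v
    using that K.gdist_unit_graph g by simp
  ultimately show ?thesis by (rule that)
qed

end

text \<open>
  A vertex \<open>y\<close> outside the image of \<open>f\<close> beyond which no geodesic from \<open>x\<close> extends is dominated,
  and removing it leaves a smaller Helly graph that still contains \<open>G\<close>.
\<close>

lemma injective_hull_geodesic_extension:
  assumes G: "conn_graph G" and hull: "is_injective_hull G H"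
    and f: "f ` verts G \<subseteq> verts H"
      "\<And>u v. u \<in> verts G \<Longrightarrow> v \<in> verts G \<Longrightarrow> gdist H (f u) (f v) = gdist G u v"
    and xy: "x \<in> verts H" "y \<in> verts H"
  shows "\<exists>v\<in>verts G. gdist H x (f v) = gdist H x y + gdist H y (f v)"
proof -
  interpret H: connected_helly_graph H
    using hull unfolding is_injective_hull_def helly_graph_def connected_helly_graph_def
      connected_helly_graph_axioms_def connected_graph_iff by blast
  \<comment> \<open>The ends of prolongations beyond \<open>y\<close>, with \<open>y\<close> itself
    included; one farthest from \<open>x\<close> will turn out to come from
    \<open>G\<close>.\<close>
  let ?Z = "{z \<in> verts H. gdist H x z = gdist H x y + gdist H y z}"
  have "y \<in> ?Z" using xy H.zero_iff[of y y] by simp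
  moreover have "finite ?Z" by simp
  ultimately have "Max (gdist H x ` ?Z) \<in> gdist H x ` ?Z" by (intro Max_in) auto
  then obtain z where z: "z \<in> ?Z" "Max (gdist H x ` ?Z) = gdist H x z" by blast
  have max: "gdist H x z' \<le> gdist H x z" if "z' \<in> ?Z" for z'
    using z(2) that \<open>finite ?Z\<close> by (metis (no_types, lifting) Max_ge finite_imageI imageI)
  have zV: "z \<in> verts H" using z by blast
  have False if nz: "z \<notin> f ` verts G"
  proof -
    \<comment> \<open>Otherwise \<open>y = x\<close> and the maximum is 0, so \<open>x\<close> is
      the only vertex of \<open>H\<close> and thus an image of \<open>G\<close>.\<close>
    have "x \<noteq> z"
    proof
      assume "x = z"
      then have "y = x" using z H.zero_iff[of x x] H.zero_iff[of x y] xy by auto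
      obtain v where v: "v \<in> verts G"
        using G unfolding conn_graph_def connected_def strongly_connected_def mk_symmetric_def by auto
      then have fv: "f v \<in> verts H" using f(1) by blast
      then have "gdist H x (f v) \<le> gdist H x z"
        using \<open>y = x\<close> H.zero_iff[of x x] xy by (intro max) auto
      then have "gdist H x (f v) = 0" using \<open>x = z\<close> H.zero_iff[of x x] xy by simp
      then have "x = f v" using H.zero_iff[OF xy(1) fv] by simp
      then show False using nz v \<open>x = z\<close> by blast
    qed
    \<comment> \<open>A neighbour of \<open>z\<close> farther from \<open>x\<close> would still
      prolong the geodesic through \<open>y\<close>, against the choice of \<open>z\<close>. So
      \<open>z\<close> is dominated.\<close>
    moreover have "gdist H x w \<le> gdist H x z" if w: "w \<in> verts H" "gdist H z w = 1" for w
    proof (rule ccontr)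
      assume gt: "\<not> gdist H x w \<le> gdist H x z"
      have "gdist H x w \<le> gdist H x y + gdist H y w" "gdist H y w \<le> gdist H y z + gdist H z w"
        using H.triangle xy zV w(1) by blast+
      then have "w \<in> ?Z" using gt z w by auto
      then show False using max gt by blast
    qed
    ultimately obtain z' where z': "z' \<in> verts H - {z}"
      "\<And>w. w \<in> verts H \<Longrightarrow> gdist H z w \<le> 1 \<Longrightarrow> gdist H z' w \<le> 1"
      using H.dominated_if_farthest[OF xy(1) zV] by blast
    obtain K :: "nat pair_pre_digraph" and e where K: "helly_graph K"
      "bij_betw e (verts H - {z}) (verts K)"
      "\<And>u v. u \<in> verts H - {z} \<Longrightarrow> v \<in> verts H - {z} \<Longrightarrow> gdist K (e u) (e v) = gdist H u v"
      using H.helly_nat_copy_remove_dominated[OF zV z'] by blast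
    have fW: "f u \<in> verts H - {z}" if "u \<in> verts G" for u using that f(1) nz by blast
    have "embeds_isometrically G K"
      unfolding embeds_isometrically_def
    proof (intro exI[of _ "e \<circ> f"] conjI ballI)
      show "(e \<circ> f) ` verts G \<subseteq> verts K" using fW K(2) by (auto simp: bij_betw_def)
      show "gdist K ((e \<circ> f) u) ((e \<circ> f) v) = gdist G u v" if "u \<in> verts G" "v \<in> verts G" for u v
        using K(3)[OF fW[OF that(1)] fW[OF that(2)]] f(2)[OF that] by simp
    qed
    with K(1) hull have "embeds_isometrically H K" unfolding is_injective_hull_def by blast
    then obtain h where h: "h ` verts H \<subseteq> verts K"
      "\<And>u v. u \<in> verts H \<Longrightarrow> v \<in> verts H \<Longrightarrow> gdist K (h u) (h v) = gdist H u v"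
      unfolding embeds_isometrically_def by blast
    interpret K: connected_graph K
      using K(1) unfolding helly_graph_def connected_graph_iff by blast
    \<comment> \<open>Isometric embeddings are injective, so \<open>H\<close> would fit into a graph
      with one vertex fewer.\<close>
    have "inj_on h (verts H)"
    proof (rule inj_onI)
      fix u v assume uv: "u \<in> verts H" "v \<in> verts H" "h u = h v"
      have "gdist K (h u) (h v) = 0" using h(1) uv K.zero_iff[of "h u" "h v"] by auto
      then show "u = v" using h(2)[OF uv(1,2)] H.zero_iff[OF uv(1,2)] by simp
    qed
    then have "card (verts H) \<le> card (verts K)" using h(1) K.finite_verts by (rule card_inj_on_le)
    also have "\<dots> = card (verts H - {z})" using K(2) by (simp add: bij_betw_same_card)
    also have "\<dots> < card (verts H)" using zV by (intro card_Diff1_less) auto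
    finally show False by simp
  qed
  then obtain v where "v \<in> verts G" "z = f v" by blast
  then show ?thesis using z by auto
qed

lemma hb_injective_hull_le_iff:
  assumes G: "conn_graph G" and hull: "is_injective_hull G H"
  shows "hb G \<le> real n / 2 \<longleftrightarrow> hb H \<le> real n / 2"
proof -
  interpret G: connected_graph G using G by (simp add: connected_graph_iff)
  interpret H: connected_graph H
    using hull unfolding is_injective_hull_def helly_graph_def connected_graph_iff by blast
  have "embeds_isometrically G H" using hull by (simp add: is_injective_hull_def)
  then obtain f where f: "f ` verts G \<subseteq> verts H"
    "\<And>u v. u \<in> verts G \<Longrightarrow> v \<in> verts G \<Longrightarrow> gdist H (f u) (f v) = gdist G u v"
    unfolding embeds_isometrically_def by blast
  let ?d = "gdist H" and ?A = "f ` verts G"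
  define bad where "bad u v w x \<longleftrightarrow> ?d u v + ?d w x > max (?d u w + ?d v x) (?d u x + ?d v w) + n"
    for u v w x
  \<comment> \<open>The symmetries of \<open>bad\<close> that bring each vertex into the first
    position, the only one that \<open>move\<close> replaces.\<close>
  have swap: "bad v u x w" "bad w x u v"
    if "bad u v w x" "u \<in> verts H" "v \<in> verts H" "w \<in> verts H" "x \<in> verts H" for u v w x
  proof -
    have s: "?d v u = ?d u v" "?d x w = ?d w x" "?d v w = ?d w v" "?d x u = ?d u x" "?d w u = ?d u w"
      "?d x v = ?d v x"
      by (rule H.sym; fact)+
    show "bad v u x w" "bad w x u v" using that(1) unfolding bad_def s by linarith+
  qed
  \<comment> \<open>The geodesic from the partner \<open>v\<close> through \<open>u\<close> is
    prolonged to \<open>a\<close>: the leading sum grows by exactly \<open>gdist H u a\<close>, the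
    other sums by at most that.\<close>
  have move: "\<exists>a\<in>?A. bad a v w x"
    if b: "bad u v w x" and V: "u \<in> verts H" "v \<in> verts H" "w \<in> verts H" "x \<in> verts H" for u v w x
  proof -
    obtain a where a: "a \<in> ?A" "?d v a = ?d v u + ?d u a"
      using injective_hull_geodesic_extension[OF G hull f V(2,1)] by blast
    then have aV: "a \<in> verts H" using f(1) by blast
    have "?d a w \<le> ?d a u + ?d u w" "?d a x \<le> ?d a u + ?d u x"
      by (rule H.triangle[OF aV V(1) V(3)], rule H.triangle[OF aV V(1) V(4)])
    moreover have "?d a v = ?d u v + ?d a u" "?d u a = ?d a u"
      using a(2) H.sym[OF V(1) V(2)] H.sym[OF V(2) aV] H.sym[OF V(1) aV] by simp_all
    ultimately have "bad a v w x" using b unfolding bad_def by auto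
    then show ?thesis using a(1) by blast
  qed
  have A: "a \<in> verts H" if "a \<in> ?A" for a using that f(1) by blast
  have "hb H \<le> real n / 2 \<longleftrightarrow> \<not> (\<exists>u\<in>verts H. \<exists>v\<in>verts H. \<exists>w\<in>verts H. \<exists>x\<in>verts H. bad u v w x)"
    unfolding H.hb_le_iff bad_def not_le[symmetric] by blast
  also have "\<dots> \<longleftrightarrow> \<not> (\<exists>u\<in>?A. \<exists>v\<in>?A. \<exists>w\<in>?A. \<exists>x\<in>?A. bad u v w x)"
  proof (intro arg_cong[of _ _ Not] iffI)
    assume "\<exists>u\<in>verts H. \<exists>v\<in>verts H. \<exists>w\<in>verts H. \<exists>x\<in>verts H. bad u v w x"
    then obtain u v w x where V: "u \<in> verts H" "v \<in> verts H" "w \<in> verts H" "x \<in> verts H"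
      and "bad u v w x" by blast
    from move[OF this(5) V] obtain a where a: "a \<in> ?A" "bad a v w x" by blast
    from move[OF swap(1)[OF a(2) A[OF a(1)] V(2-4)] V(2) A[OF a(1)] V(4,3)]
    obtain b where b: "b \<in> ?A" "bad b a x w" by blast
    from move[OF swap(2)[OF b(2) A[OF b(1)] A[OF a(1)] V(4,3)] V(4,3) A[OF b(1)] A[OF a(1)]]
    obtain c where c: "c \<in> ?A" "bad c w b a" by blast
    from move[OF swap(1)[OF c(2) A[OF c(1)] V(3) A[OF b(1)] A[OF a(1)]] V(3) A[OF c(1)] A[OF a(1)] A[OF b(1)]]
    obtain e where "e \<in> ?A" "bad e c a b" by blast
    then show "\<exists>u\<in>?A. \<exists>v\<in>?A. \<exists>w\<in>?A. \<exists>x\<in>?A. bad u v w x" using a(1) b(1) c(1) by blast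
  next
    assume "\<exists>u\<in>?A. \<exists>v\<in>?A. \<exists>w\<in>?A. \<exists>x\<in>?A. bad u v w x"
    then show "\<exists>u\<in>verts H. \<exists>v\<in>verts H. \<exists>w\<in>verts H. \<exists>x\<in>verts H. bad u v w x" using A by blast
  qed
  also have "\<dots> \<longleftrightarrow> hb G \<le> real n / 2"
    unfolding G.hb_le_iff bad_def by (simp add: f(2) not_less)
  finally show ?thesis by blast
qed

text \<open>A triple \<open>(v, p, r)\<close> says that \<open>v\<close> hangs on the point
  \<open>p\<close> by a tail of length \<open>r\<close>. Points are placed one at a time: by the
  triangle inequality through \<open>x\<close> the disks of radius \<open>r + D x p\<close> meet
  pairwise, and a common point \<open>z\<close> becomes the constraint \<open>(z, x, 0)\<close> for
  the rest. This keeps the map nonexpansive and preserves the hypothesis on \<open>C\<close>, over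
  which the induction generalises. The laws of \<open>D\<close> hold on the whole type because
  \<open>x\<close> is then outside the remaining set.\<close>

lemma (in connected_helly_graph) nonexpansive_extension:
  fixes D :: "'p \<Rightarrow> 'p \<Rightarrow> nat"
  assumes "finite X"
    and refl: "\<And>p. D p p = 0" and symD: "\<And>p q. D p q = D q p"
    and tri: "\<And>p q r. D p r \<le> D p q + D q r"
    and "\<And>v p r. (v, p, r) \<in> C \<Longrightarrow> v \<in> verts G"
    and "\<And>v p r v' p' r'. (v, p, r) \<in> C \<Longrightarrow> (v', p', r') \<in> C \<Longrightarrow> gdist G v v' \<le> r + r' + D p p'"
  shows "\<exists>\<phi>. \<phi> ` X \<subseteq> verts G \<and> (\<forall>u\<in>X. \<forall>w\<in>X. gdist G (\<phi> u) (\<phi> w) \<le> D u w) \<and>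
    (\<forall>u\<in>X. \<forall>(v, p, r)\<in>C. gdist G (\<phi> u) v \<le> r + D u p)"
  using assms(1,5,6)
proof (induction X arbitrary: C rule: finite_induct)
  case empty
  then show ?case by simp
next
  case (insert x X)
  let ?C = "(\<lambda>(v, p, r). (v, r + D x p)) ` C"
  have "gdist G v v' \<le> (r + D x p) + (r' + D x p')" if "(v, p, r) \<in> C" "(v', p', r') \<in> C" for v p r v' p' r'
    using insert.prems(2)[OF that] tri[of p p' x] symD[of p x] by simp
  then have "\<exists>z\<in>verts G. \<forall>(v, r)\<in>?C. gdist G z v \<le> r"
    using insert.prems(1) by (intro helly_point) auto
  then obtain z where z1: "z \<in> verts G" and "\<forall>(v, r)\<in>?C. gdist G z v \<le> r" by blast
  then have z2: "gdist G z v \<le> r + D x p" if "(v, p, r) \<in> C" for v p r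
    using that by (auto dest: bspec)
  note z = z1 z2
  have z': "gdist G v z \<le> r + D p x" if "(v, p, r) \<in> C" for v p r
    using z(2)[OF that] sym[OF z(1) insert.prems(1)[OF that]] symD[of x p] by simp
  have zz: "gdist G z z = 0" using zero_iff z(1) by blast
  have "\<exists>\<phi>. \<phi> ` X \<subseteq> verts G \<and> (\<forall>u\<in>X. \<forall>w\<in>X. gdist G (\<phi> u) (\<phi> w) \<le> D u w) \<and>
    (\<forall>u\<in>X. \<forall>(v, p, r)\<in>insert (z, x, 0) C. gdist G (\<phi> u) v \<le> r + D u p)"
  proof (rule insert.IH)
    show "v \<in> verts G" if "(v, p, r) \<in> insert (z, x, 0) C" for v p r
      using that z(1) insert.prems(1) by auto
    show "gdist G v v' \<le> r + r' + D p p'"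
      if "(v, p, r) \<in> insert (z, x, 0) C" "(v', p', r') \<in> insert (z, x, 0) C" for v p r v' p' r'
      using that insert.prems(2) z(2) z' zz by auto
  qed
  then obtain \<phi> where phi: "\<phi> ` X \<subseteq> verts G" "\<And>u w. u \<in> X \<Longrightarrow> w \<in> X \<Longrightarrow> gdist G (\<phi> u) (\<phi> w) \<le> D u w"
    "\<And>u. u \<in> X \<Longrightarrow> gdist G (\<phi> u) z \<le> D u x"
    "\<And>u v p r. u \<in> X \<Longrightarrow> (v, p, r) \<in> C \<Longrightarrow> gdist G (\<phi> u) v \<le> r + D u p"
  proof (elim exE conjE, goal_cases)
    case (1 \<phi>)
    then show ?case by (intro 1(1)[of \<phi>]) (auto dest!: bspec)
  qed
  have phi': "gdist G z (\<phi> u) \<le> D x u" if "u \<in> X" for u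
    using phi(3)[OF that] sym[OF z(1), of "\<phi> u"] phi(1) that symD[of x u] by auto
  show ?case
  proof (intro exI[of _ "\<phi>(x := z)"] conjI ballI)
    show "(\<phi>(x := z)) ` insert x X \<subseteq> verts G" using phi(1) z(1) by auto
    show "gdist G ((\<phi>(x := z)) u) ((\<phi>(x := z)) w) \<le> D u w" if "u \<in> insert x X" "w \<in> insert x X" for u w
      using that phi(2,3) phi' zz by auto
    show "case c of (v, p, r) \<Rightarrow> gdist G ((\<phi>(x := z)) u) v \<le> r + D u p" if "u \<in> insert x X" "c \<in> C" for u c
      using that phi(4) z(2) by auto
  qed
qed

text \<open>
  A nonexpansive extension is an isometry as soon as any two points of \<open>X\<close> lie on a common geodesic
  between two constraints whose distance is attained.
\<close>

lemma (in connected_helly_graph) contains_isometric_unit_graph_of_constraints: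
  fixes D :: "'p \<Rightarrow> 'p \<Rightarrow> nat"
  assumes "geodesic_metric X D" "finite X" "X \<noteq> {}"
    and D: "\<And>p. D p p = 0" "\<And>p q. D p q = D q p" "\<And>p q r. D p r \<le> D p q + D q r"
    and C: "\<And>v p r. (v, p, r) \<in> C \<Longrightarrow> v \<in> verts G"
      "\<And>v p r v' p' r'. (v, p, r) \<in> C \<Longrightarrow> (v', p', r') \<in> C \<Longrightarrow> gdist G v v' \<le> r + r' + D p p'"
    and tight: "\<And>u w. u \<in> X \<Longrightarrow> w \<in> X \<Longrightarrow> \<exists>(v, p, r)\<in>C. \<exists>(v', p', r')\<in>C.
      D p u + D u w + D w p' \<le> D p p' \<and> gdist G v v' = r + r' + D p p'"
  shows "contains_isometric G (unit_graph X D)"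
proof -
  have "\<exists>\<phi>. \<phi> ` X \<subseteq> verts G \<and> (\<forall>u\<in>X. \<forall>w\<in>X. gdist G (\<phi> u) (\<phi> w) \<le> D u w) \<and>
    (\<forall>u\<in>X. \<forall>(v, p, r)\<in>C. gdist G (\<phi> u) v \<le> r + D u p)"
  proof (rule nonexpansive_extension[OF assms(2) D])
    show "v \<in> verts G" if "(v, p, r) \<in> C" for v p r using C(1)[OF that] .
    show "gdist G v v' \<le> r + r' + D p p'" if "(v, p, r) \<in> C" "(v', p', r') \<in> C" for v p r v' p' r'
      using C(2)[OF that] .
  qed
  then obtain \<phi> where phi1: "\<phi> ` X \<subseteq> verts G" "\<forall>u\<in>X. \<forall>w\<in>X. gdist G (\<phi> u) (\<phi> w) \<le> D u w"
    and "\<forall>u\<in>X. \<forall>(v, p, r)\<in>C. gdist G (\<phi> u) v \<le> r + D u p"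
    by blast
  then have phi3: "gdist G (\<phi> u) v \<le> r + D u p" if "u \<in> X" "(v, p, r) \<in> C" for u v p r
    using that by (auto dest!: bspec)
  note phi = phi1(1) phi1(2)[rule_format] phi3
  have "gdist G (\<phi> u) (\<phi> w) = D u w" if uw: "u \<in> X" "w \<in> X" for u w
  proof -
    obtain v p r v' p' r' where c: "(v, p, r) \<in> C" "(v', p', r') \<in> C"
      "D p u + D u w + D w p' \<le> D p p'" "gdist G v v' = r + r' + D p p'"
      using tight[OF uw] by (elim bexE case_prodE) auto
    have V: "v \<in> verts G" "v' \<in> verts G" "\<phi> u \<in> verts G" "\<phi> w \<in> verts G"
      using C(1) c(1,2) phi(1) uw by auto
    \<comment> \<open>The outer terms are at most \<open>r + D p u\<close> and
      \<open>r' + D w p'\<close>, so tightness leaves at least \<open>D u w\<close> for the middle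
      one.\<close>
    have "gdist G v v' \<le> gdist G v (\<phi> u) + gdist G (\<phi> u) (\<phi> w) + gdist G (\<phi> w) v'"
      using triangle[OF V(1) V(3) V(2)] triangle[OF V(3) V(4) V(2)] by linarith
    moreover have "gdist G v (\<phi> u) \<le> r + D p u"
      using phi(3)[OF uw(1) c(1)] sym[OF V(1,3)] D(2)[of u p] by simp
    ultimately show ?thesis
      using phi(2)[OF uw] phi(3)[OF uw(2) c(2)] c(3,4) by linarith
  qed
  then show ?thesis using contains_isometric_unit_graphI[OF assms(1,3) phi(1)] by blast
qed

section \<open>Regions of the King-grid\<close>

definition cheb :: "int \<times> int \<Rightarrow> int \<times> int \<Rightarrow> nat" where
  "cheb u v = nat (max \<bar>fst u - fst v\<bar> \<bar>snd u - snd v\<bar>)"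

lemma int_cheb: "int (cheb (x, y) (x', y')) = max \<bar>x - x'\<bar> \<bar>y - y'\<bar>"
  by (simp add: cheb_def le_max_iff_disj)

lemma cheb_refl: "cheb u u = 0"
  by (simp add: cheb_def)

lemma cheb_sym: "cheb u v = cheb v u"
  by (simp add: cheb_def abs_minus_commute)

lemma cheb_triangle: "cheb u w \<le> cheb u v + cheb v w"
proof -
  have "\<bar>fst u - fst w\<bar> \<le> \<bar>fst u - fst v\<bar> + \<bar>fst v - fst w\<bar>"
    "\<bar>snd u - snd w\<bar> \<le> \<bar>snd u - snd v\<bar> + \<bar>snd v - snd w\<bar>" by linarith+
  then have "max \<bar>fst u - fst w\<bar> \<bar>snd u - snd w\<bar> \<le>
      max \<bar>fst u - fst v\<bar> \<bar>snd u - snd v\<bar> + max \<bar>fst v - fst w\<bar> \<bar>snd v - snd w\<bar>"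
    by (meson add_mono max.cobounded1 max.cobounded2 max.boundedI order_trans)
  then show ?thesis
    unfolding cheb_def by (subst nat_add_distrib[symmetric]) (auto intro: nat_mono)
qed

lemma cheb_eq_0_iff: "cheb u v = 0 \<longleftrightarrow> u = v"
  by (auto simp: cheb_def prod_eq_iff)

text \<open>A coordinate moves only if its difference is maximal, so the step is diagonal only on
  exact diagonals. It then never overshoots the target in \<open>x + y\<close> or
  \<open>x - y\<close>, hence stays in every box given by bounds on these two.\<close>

definition king_step :: "int \<times> int \<Rightarrow> int \<times> int \<Rightarrow> int \<times> int" where
  "king_step u v = (let dx = fst v - fst u; dy = snd v - snd u in
     (fst u + (if \<bar>dy\<bar> \<le> \<bar>dx\<bar> then sgn dx else 0), snd u + (if \<bar>dx\<bar> \<le> \<bar>dy\<bar> then sgn dy else 0)))"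

text \<open>The eight king moves with the sector of \<open>(dx, dy)\<close> in which each is taken,
  free of \<open>sgn\<close> and conditionals for case analyses in linear arithmetic.\<close>

definition step_toward :: "int \<Rightarrow> int \<Rightarrow> int \<Rightarrow> int \<Rightarrow> bool" where
  "step_toward dx dy i j \<longleftrightarrow>
     i = 1 \<and> j = 0 \<and> \<bar>dy\<bar> < dx \<or> i = -1 \<and> j = 0 \<and> \<bar>dy\<bar> < - dx \<or>
     i = 0 \<and> j = 1 \<and> \<bar>dx\<bar> < dy \<or> i = 0 \<and> j = -1 \<and> \<bar>dx\<bar> < - dy \<or>
     i = 1 \<and> j = 1 \<and> dx = dy \<and> 0 < dx \<or> i = -1 \<and> j = -1 \<and> dx = dy \<and> dx < 0 \<or>
     i = 1 \<and> j = -1 \<and> dx = - dy \<and> 0 < dx \<or> i = -1 \<and> j = 1 \<and> dx = - dy \<and> dx < 0"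

lemma king_step_cases:
  assumes "(x, y) \<noteq> (x', y')"
  obtains i j where "king_step (x, y) (x', y') = (x + i, y + j)"
    "king_step (x', y') (x, y) = (x' - i, y' - j)" "step_toward (x' - x) (y' - y) i j"
proof
  define i where "i = (if \<bar>y' - y\<bar> \<le> \<bar>x' - x\<bar> then sgn (x' - x) else 0)"
  define j where "j = (if \<bar>x' - x\<bar> \<le> \<bar>y' - y\<bar> then sgn (y' - y) else 0)"
  show "king_step (x, y) (x', y') = (x + i, y + j)"
    by (simp add: king_step_def Let_def i_def j_def)
  have "sgn (x - x') = - sgn (x' - x)" "sgn (y - y') = - sgn (y' - y)" by (simp_all add: sgn_if)
  then show "king_step (x', y') (x, y) = (x' - i, y' - j)"
    by (simp add: king_step_def Let_def i_def j_def abs_minus_commute[of x] abs_minus_commute[of y])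
  show "step_toward (x' - x) (y' - y) i j"
    using assms unfolding step_toward_def i_def j_def sgn_if by (smt (verit))
qed

lemma cheb_king_step:
  assumes "u \<noteq> v"
  shows "cheb u (king_step u v) = 1" "cheb u (king_step u v) + cheb (king_step u v) v = cheb u v"
proof -
  obtain x y x' y' where uv: "u = (x, y)" "v = (x', y')" by (cases u; cases v)
  obtain i j where s: "king_step u v = (x + i, y + j)" and c:
    "step_toward (x' - x) (y' - y) i j"
    using assms unfolding uv by (rule king_step_cases)
  from c have "max \<bar>i\<bar> \<bar>j\<bar> = 1"
    unfolding step_toward_def by (elim disjE) simp_all
  then show 1: "cheb u (king_step u v) = 1" unfolding s unfolding uv by (simp add: cheb_def)
  from c have "1 + max \<bar>x + i - x'\<bar> \<bar>y + j - y'\<bar> = max \<bar>x - x'\<bar> \<bar>y - y'\<bar>"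
    unfolding step_toward_def by (smt (verit))
  then have "1 + int (cheb (x + i, y + j) (x', y')) = int (cheb (x, y) (x', y'))"
    unfolding int_cheb .
  then show "cheb u (king_step u v) + cheb (king_step u v) v = cheb u v"
    unfolding 1 unfolding s unfolding uv by linarith
qed

text \<open>
  The extra corner points make the regions non-convex: the step in one of the two directions may
  leave the region.
\<close>

lemma geodesic_metric_cheb:
  assumes "\<And>u v. u \<in> X \<Longrightarrow> v \<in> X \<Longrightarrow> u \<noteq> v \<Longrightarrow> king_step u v \<in> X \<or> king_step v u \<in> X"
  shows "geodesic_metric X cheb"
proof
  fix u v assume uv: "u \<in> X" "v \<in> X" "2 \<le> cheb u v"
  then have ne: "u \<noteq> v" by (auto simp: cheb_refl)
  from assms[OF uv(1,2) ne] show "\<exists>w\<in>X. w \<noteq> u \<and> w \<noteq> v \<and> cheb u w + cheb w v = cheb u v"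
  proof
    assume "king_step u v \<in> X"
    moreover have "king_step u v \<noteq> u" "king_step u v \<noteq> v"
      using cheb_king_step[OF ne] uv(3) by (auto simp: cheb_refl)
    ultimately show ?thesis using cheb_king_step(2)[OF ne] by blast
  next
    assume "king_step v u \<in> X"
    moreover have "king_step v u \<noteq> u" "king_step v u \<noteq> v"
      using cheb_king_step[OF ne[symmetric]] uv(3) cheb_sym[of u v] by (auto simp: cheb_refl)
    moreover have "cheb u (king_step v u) + cheb (king_step v u) v = cheb u v"
      using cheb_king_step(2)[OF ne[symmetric]] cheb_sym[of u v] cheb_sym[of v "king_step v u"]
        cheb_sym[of u "king_step v u"] by linarith
    ultimately show ?thesis by blast
  qed
qed (rule cheb_eq_0_iff cheb_sym cheb_triangle)+

lemma king_grid_induce: "king_grid \<restriction> X = with_proj (unit_graph X cheb)"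
proof (rule pre_digraph.equality)
  have "cheb (x, y) (x', y') = 1 \<longleftrightarrow> max \<bar>x - x'\<bar> \<bar>y - y'\<bar> = 1" for x y x' y'
    using int_cheb[of x y x' y'] by linarith
  then show "arcs (king_grid \<restriction> X) = arcs (unit_graph X cheb)"
    by (auto simp: king_grid_def)
qed simp_all

section \<open>The three regions and their path metrics\<close>

definition region1 :: "nat \<Rightarrow> (int \<times> int) set" where
  "region1 k = {(x, y). 0 \<le> x + y \<and> x + y \<le> 2 * int k \<and> 0 \<le> x - y \<and> x - y \<le> 2 * int k}"

text \<open>The second extra point, \<open>(2 * k + 1, 1)\<close>, is left unsimplified so that
  \<open>H2 k k\<close> unfolds to it literally.\<close>

definition region2 :: "nat \<Rightarrow> (int \<times> int) set" where
  "region2 k = {(x, y). 0 \<le> x + y \<and> x + y \<le> 2 * int k + 1 \<and> -1 \<le> x - y \<and> x - y \<le> 2 * int k} \<union>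
      {(-1, 0), (int k + int k + 1, int k - int k + 1)}"

definition region3 :: "nat \<Rightarrow> (int \<times> int) set" where
  "region3 k = {(x, y). 0 \<le> x + y \<and> x + y \<le> 2 * int k + 2 \<and> -1 \<le> x - y \<and> x - y \<le> 2 * int k + 1} \<union>
      {(int k, - int k - 1), (-1, 1), (int k + 1, int k + 2), (int k + int k + 2, int k - int k)}"

lemma H_eq_unit_graph:
  "H1 k k = with_proj (unit_graph (region1 k) cheb)"
  "H2 k k = with_proj (unit_graph (region2 k) cheb)"
  "H3 k k = with_proj (unit_graph (region3 k) cheb)"
  unfolding H1_def H2_def H3_def king_grid_induce region1_def region2_def region3_def by (rule refl)+

lemma region_bounded:
  "region1 k \<subseteq> {-1..2 * int k + 2} \<times> {- int k - 1..int k + 2}"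
  "region2 k \<subseteq> {-1..2 * int k + 2} \<times> {- int k - 1..int k + 2}"
  "region3 k \<subseteq> {-1..2 * int k + 2} \<times> {- int k - 1..int k + 2}"
  by (auto simp: region1_def region2_def region3_def)

lemma finite_region: "finite (region1 k)" "finite (region2 k)" "finite (region3 k)"
  by (rule finite_subset[OF region_bounded(1)], simp)
    (rule finite_subset[OF region_bounded(2)], simp,
     rule finite_subset[OF region_bounded(3)], simp)

lemma mem_region1_iff:
  "(x, y) \<in> region1 k \<longleftrightarrow> 0 \<le> x + y \<and> x + y \<le> 2 * int k \<and> 0 \<le> x - y \<and> x - y \<le> 2 * int k"
  by (simp add: region1_def)

lemma mem_region2_iff:
  "(x, y) \<in> region2 k \<longleftrightarrow>
    0 \<le> x + y \<and> x + y \<le> 2 * int k + 1 \<and> -1 \<le> x - y \<and> x - y \<le> 2 * int k \<or>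
    x = -1 \<and> y = 0 \<or> x = 2 * int k + 1 \<and> y = 1"
  by (auto simp: region2_def)

lemma mem_region3_iff:
  "(x, y) \<in> region3 k \<longleftrightarrow>
    0 \<le> x + y \<and> x + y \<le> 2 * int k + 2 \<and> -1 \<le> x - y \<and> x - y \<le> 2 * int k + 1 \<or>
    x = int k \<and> y = - int k - 1 \<or> x = -1 \<and> y = 1 \<or>
    x = int k + 1 \<and> y = int k + 2 \<or> x = 2 * int k + 2 \<and> y = 0"
  by (auto simp: region3_def)

lemma geodesic_metric_region1: "geodesic_metric (region1 k) cheb"
proof (rule geodesic_metric_cheb)
  fix u v assume "u \<in> region1 k" "v \<in> region1 k" and ne: "u \<noteq> v"
  moreover obtain x y x' y' where uv: "u = (x, y)" "v = (x', y')" by (cases u; cases v)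
  ultimately have mem: "(x, y) \<in> region1 k" "(x', y') \<in> region1 k" by simp_all
  from ne[unfolded uv] show "king_step u v \<in> region1 k \<or> king_step v u \<in> region1 k"
    unfolding uv
  proof (rule king_step_cases)
    fix i j assume *: "king_step (x, y) (x', y') = (x + i, y + j)" "king_step (x', y') (x, y) = (x' - i, y' - j)"
      and st: "step_toward (x' - x) (y' - y) i j"
    have k: "0 \<le> int k" by simp
    show "king_step (x, y) (x', y') \<in> region1 k \<or> king_step (x', y') (x, y) \<in> region1 k"
      using mem unfolding * mem_region1_iff
      using st unfolding step_toward_def by (smt (verit))
  qed
qed

text \<open>In the coordinates \<open>x + y\<close> and \<open>x - y\<close> the bulk is a box with
  the two extra corners just outside. A step out of an extra corner enters the box, whereas a step
  towards one may leave the region.\<close>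

lemma geodesic_metric_region2: "geodesic_metric (region2 k) cheb"
proof (rule geodesic_metric_cheb)
  fix u v assume "u \<in> region2 k" "v \<in> region2 k" and ne: "u \<noteq> v"
  moreover obtain x y x' y' where uv: "u = (x, y)" "v = (x', y')" by (cases u; cases v)
  ultimately have mem: "(x, y) \<in> region2 k" "(x', y') \<in> region2 k" by simp_all
  from ne[unfolded uv] show "king_step u v \<in> region2 k \<or> king_step v u \<in> region2 k"
    unfolding uv
  proof (rule king_step_cases)
    fix i j assume *: "king_step (x, y) (x', y') = (x + i, y + j)" "king_step (x', y') (x, y) = (x' - i, y' - j)"
      and st: "step_toward (x' - x) (y' - y) i j"
    have k: "0 \<le> int k" by simp
    show "king_step (x, y) (x', y') \<in> region2 k \<or> king_step (x', y') (x, y) \<in> region2 k"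
      using mem unfolding * mem_region2_iff
    proof (elim disjE, goal_cases)
    qed (use st[unfolded step_toward_def] k in \<open>(smt (z3))+\<close>)
  qed
qed

text \<open>Between neighbouring extra corners just one of the two steps stays: from
  \<open>(2 * k + 2, 0)\<close> towards \<open>(k, - k - 1)\<close> it does, while the opposite one
  raises \<open>x - y\<close> to \<open>2 * k + 2\<close>.\<close>

lemma geodesic_metric_region3: "geodesic_metric (region3 k) cheb"
proof (rule geodesic_metric_cheb)
  fix u v assume "u \<in> region3 k" "v \<in> region3 k" and ne: "u \<noteq> v"
  moreover obtain x y x' y' where uv: "u = (x, y)" "v = (x', y')" by (cases u; cases v)
  ultimately have mem: "(x, y) \<in> region3 k" "(x', y') \<in> region3 k" by simp_all
  from ne[unfolded uv] show "king_step u v \<in> region3 k \<or> king_step v u \<in> region3 k"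
    unfolding uv
  proof (rule king_step_cases)
    fix i j assume *: "king_step (x, y) (x', y') = (x + i, y + j)" "king_step (x', y') (x, y) = (x' - i, y' - j)"
      and st: "step_toward (x' - x) (y' - y) i j"
    have k: "0 \<le> int k" by simp
    show "king_step (x, y) (x', y') \<in> region3 k \<or> king_step (x', y') (x, y) \<in> region3 k"
      using mem unfolding * mem_region3_iff
    proof (elim disjE, goal_cases)
    qed (use st[unfolded step_toward_def] k in \<open>(smt (z3))+\<close>)
  qed
qed

section \<open>Pairs of points on geodesics between corners\<close>

definition cheb_between :: "int \<times> int \<Rightarrow> int \<times> int \<Rightarrow> int \<times> int \<Rightarrow> int \<times> int \<Rightarrow> bool" where
  "cheb_between p u w q \<longleftrightarrow> cheb p u + cheb u w + cheb w q \<le> cheb p q"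

lemma cheb_between_commute: "cheb_between p u w q \<longleftrightarrow> cheb_between q w u p"
  unfolding cheb_between_def by (simp add: cheb_sym[of p] cheb_sym[of u w] cheb_sym[of w q] add_ac)

text \<open>If each point lies in the right cone of its predecessor, distances are differences of
  first coordinates and telescope.\<close>

lemma cheb_between_horizontal:
  assumes "\<bar>y1 - y0\<bar> \<le> x1 - x0" "\<bar>y2 - y1\<bar> \<le> x2 - x1" "\<bar>y3 - y2\<bar> \<le> x3 - x2"
  shows "cheb_between (x0, y0) (x1, y1) (x2, y2) (x3, y3)"
proof -
  have cheb: "int (cheb (x, y) (x', y')) = x' - x" if "\<bar>y' - y\<bar> \<le> x' - x" for x y x' y'
    using that by (simp add: int_cheb abs_minus_commute[of x] abs_minus_commute[of y])
  have "\<bar>y3 - y0\<bar> \<le> x3 - x0" using assms by linarith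
  from cheb[OF this] cheb[OF assms(1)] cheb[OF assms(2)] cheb[OF assms(3)] show ?thesis
    unfolding cheb_between_def by linarith
qed

lemma cheb_between_vertical:
  assumes "\<bar>x1 - x0\<bar> \<le> y1 - y0" "\<bar>x2 - x1\<bar> \<le> y2 - y1" "\<bar>x3 - x2\<bar> \<le> y3 - y2"
  shows "cheb_between (x0, y0) (x1, y1) (x2, y2) (x3, y3)"
proof -
  have cheb: "int (cheb (x, y) (x', y')) = y' - y" if "\<bar>x' - x\<bar> \<le> y' - y" for x y x' y'
    using that by (simp add: int_cheb abs_minus_commute[of x] abs_minus_commute[of y])
  have "\<bar>x3 - x0\<bar> \<le> y3 - y0" using assms by linarith
  from cheb[OF this] cheb[OF assms(1)] cheb[OF assms(2)] cheb[OF assms(3)] show ?thesis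
    unfolding cheb_between_def by linarith
qed

text \<open>One of two points always lies in the right or the upper cone of the other, and
  \<open>T\<close> is closed under reversal.\<close>

lemma between_corners_of_oriented:
  assumes comm: "\<And>p q. (p, q) \<in> T \<Longrightarrow> (q, p) \<in> T"
    and horizontal: "\<And>x y x' y'. (x, y) \<in> X \<Longrightarrow> (x', y') \<in> X \<Longrightarrow> \<bar>y' - y\<bar> \<le> x' - x \<Longrightarrow>
      \<exists>(p, q)\<in>T. cheb_between p (x, y) (x', y') q"
    and vertical: "\<And>x y x' y'. (x, y) \<in> X \<Longrightarrow> (x', y') \<in> X \<Longrightarrow> \<bar>x' - x\<bar> \<le> y' - y \<Longrightarrow>
      \<exists>(p, q)\<in>T. cheb_between p (x, y) (x', y') q"
    and uw: "u \<in> X" "w \<in> X"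
  shows "\<exists>(p, q)\<in>T. cheb_between p u w q"
proof -
  have swap: "\<exists>(p, q)\<in>T. cheb_between p u w q" if "\<exists>(p, q)\<in>T. cheb_between p w u q"
    using that comm cheb_between_commute by fast
  obtain x y x' y' where e: "u = (x, y)" "w = (x', y')" by (cases u; cases w)
  consider "\<bar>y' - y\<bar> \<le> x' - x" | "\<bar>y - y'\<bar> \<le> x - x'" | "\<bar>x' - x\<bar> \<le> y' - y" | "\<bar>x - x'\<bar> \<le> y - y'"
    by linarith
  then show ?thesis
    using horizontal[of x y x' y'] horizontal[of x' y' x y] vertical[of x y x' y'] vertical[of x' y' x y]
      swap uw unfolding e by cases blast+
qed

text \<open>The region is the right cone of \<open>(0, 0)\<close> cut with the left cone of
  \<open>(2 * k, 0)\<close>, and equally the upper cone of the lowest corner cut with the lower cone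
  of the highest.\<close>

lemma region1_between:
  assumes "u \<in> region1 k" "w \<in> region1 k"
  shows "\<exists>(p, q)\<in>{((0, 0), (2 * int k, 0)), ((2 * int k, 0), (0, 0)),
    ((int k, - int k), (int k, int k)), ((int k, int k), (int k, - int k))}. cheb_between p u w q"
proof (rule between_corners_of_oriented[OF _ _ _ assms])
  fix x y x' y' assume m: "(x, y) \<in> region1 k" "(x', y') \<in> region1 k"
  {
    assume "\<bar>y' - y\<bar> \<le> x' - x"
    then have "cheb_between (0, 0) (x, y) (x', y') (2 * int k, 0)"
      using m unfolding mem_region1_iff by (intro cheb_between_horizontal) linarith+
    then show "\<exists>(p, q)\<in>{((0, 0), (2 * int k, 0)), ((2 * int k, 0), (0, 0)),
      ((int k, - int k), (int k, int k)), ((int k, int k), (int k, - int k))}. cheb_between p (x, y) (x', y') q"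
      by simp
  next
    assume "\<bar>x' - x\<bar> \<le> y' - y"
    then have "cheb_between (int k, - int k) (x, y) (x', y') (int k, int k)"
      using m unfolding mem_region1_iff by (intro cheb_between_vertical) linarith+
    then show "\<exists>(p, q)\<in>{((0, 0), (2 * int k, 0)), ((2 * int k, 0), (0, 0)),
      ((int k, - int k), (int k, int k)), ((int k, int k), (int k, - int k))}. cheb_between p (x, y) (x', y') q"
      by simp
  }
qed blast

lemma region2_between:
  assumes "u \<in> region2 k" "w \<in> region2 k"
  shows "\<exists>(p, q)\<in>{((-1, 0), (2 * int k + 1, 1)), ((2 * int k + 1, 1), (-1, 0)),
    ((int k, - int k), (int k, int k + 1)), ((int k, int k + 1), (int k, - int k))}. cheb_between p u w q"
proof (rule between_corners_of_oriented[OF _ _ _ assms])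
  fix x y x' y' assume m: "(x, y) \<in> region2 k" "(x', y') \<in> region2 k"
  have ac: "cheb_between (-1, 0) (x, y) (x', y') (2 * int k + 1, 1)" if "\<bar>y' - y\<bar> \<le> x' - x"
    using m that unfolding mem_region2_iff by (intro cheb_between_horizontal) linarith+
  then show "\<exists>(p, q)\<in>{((-1, 0), (2 * int k + 1, 1)), ((2 * int k + 1, 1), (-1, 0)),
    ((int k, - int k), (int k, int k + 1)), ((int k, int k + 1), (int k, - int k))}. cheb_between p (x, y) (x', y') q"
    if "\<bar>y' - y\<bar> \<le> x' - x" using that by simp
  assume v: "\<bar>x' - x\<bar> \<le> y' - y"
  \<comment> \<open>Neither extra corner lies between this vertical pair, but a vertical pair of
    points containing one is also horizontal, so \<open>ac\<close> covers it.\<close>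
  have "cheb_between (int k, - int k) (x, y) (x', y') (int k, int k + 1)"
    if "\<not> \<bar>y' - y\<bar> \<le> x' - x"
    using m that v unfolding mem_region2_iff by (intro cheb_between_vertical) linarith+
  then show "\<exists>(p, q)\<in>{((-1, 0), (2 * int k + 1, 1)), ((2 * int k + 1, 1), (-1, 0)),
    ((int k, - int k), (int k, int k + 1)), ((int k, int k + 1), (int k, - int k))}. cheb_between p (x, y) (x', y') q"
    using ac by auto
qed blast

text \<open>The sides must be listed too: the way from \<open>a\<close> to \<open>c\<close> through
  \<open>b\<close> or \<open>d\<close> has length \<open>2 * k + 4\<close>, one more than the
  diagonal, and likewise from \<open>b\<close> to \<open>d\<close>. So no geodesic between opposite
  corners contains two adjacent ones.\<close>

lemma region3_between:
  assumes "u \<in> region3 k" "w \<in> region3 k"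
  defines "a \<equiv> (int k, - int k - 1)" and "b \<equiv> (-1, 1)" and "c \<equiv> (int k + 1, int k + 2)" and "d \<equiv> (2 * int k + 2, 0)"
  shows "\<exists>(p, q)\<in>{(a, c), (c, a), (b, d), (d, b), (a, b), (b, a), (b, c), (c, b), (c, d), (d, c), (d, a), (a, d)}.
    cheb_between p u w q"
proof (rule between_corners_of_oriented[OF _ _ _ assms(1,2)])
  fix x y x' y' assume m: "(x, y) \<in> region3 k" "(x', y') \<in> region3 k"
  have k: "0 \<le> int k" by simp
  let ?T = "{(a, c), (c, a), (b, d), (d, b), (a, b), (b, a), (b, c), (c, b), (c, d), (d, c), (d, a), (a, d)}"
  {
    assume h: "\<bar>y' - y\<bar> \<le> x' - x"
    \<comment> \<open>Only \<open>a\<close> is outside the right cone of \<open>b\<close>, and only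
      \<open>c\<close> outside the left cone of \<open>d\<close>; so \<open>b\<close> and
      \<open>d\<close> serve unless \<open>(x, y)\<close> is \<open>a\<close> or
      \<open>(x', y')\<close> is \<open>c\<close>.\<close>
    consider "\<bar>y - 1\<bar> \<le> x + 1" "\<bar>y'\<bar> \<le> 2 * int k + 2 - x'"
      | "\<bar>x - int k\<bar> \<le> y + int k + 1" "\<bar>x' - x\<bar> \<le> y' - y" "\<bar>int k + 1 - x'\<bar> \<le> int k + 2 - y'"
      | "\<bar>y + int k + 1\<bar> \<le> x - int k" "\<bar>y'\<bar> \<le> 2 * int k + 2 - x'"
      | "\<bar>y - 1\<bar> \<le> x + 1" "\<bar>int k + 2 - y'\<bar> \<le> int k + 1 - x'"
      using m[unfolded mem_region3_iff]
    proof (elim disjE, goal_cases)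
    qed (use h k in \<open>(smt (verit))+\<close>)
    then show "\<exists>(p, q)\<in>?T. cheb_between p (x, y) (x', y') q"
    proof cases
      case 1
      then have "cheb_between b (x, y) (x', y') d"
        unfolding b_def d_def using h by (intro cheb_between_horizontal) linarith+
      then show ?thesis by simp
    next
      case 2
      then have "cheb_between a (x, y) (x', y') c"
        unfolding a_def c_def by (intro cheb_between_vertical) linarith+
      then show ?thesis by simp
    next
      case 3
      then have "cheb_between a (x, y) (x', y') d"
        unfolding a_def d_def using h by (intro cheb_between_horizontal) linarith+
      then show ?thesis by simp
    next
      case 4
      then have "cheb_between b (x, y) (x', y') c"
        unfolding b_def c_def using h by (intro cheb_between_horizontal) linarith+
      then show ?thesis by simp
    qed
  next
    assume v: "\<bar>x' - x\<bar> \<le> y' - y"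
    \<comment> \<open>Likewise \<open>a\<close> and \<open>c\<close> serve unless
      \<open>(x, y)\<close> is \<open>d\<close> or \<open>(x', y')\<close> is
      \<open>b\<close>.\<close>
    consider "\<bar>x - int k\<bar> \<le> y + int k + 1" "\<bar>int k + 1 - x'\<bar> \<le> int k + 2 - y'"
      | "\<bar>y' - 1\<bar> \<le> x' + 1" "\<bar>y - y'\<bar> \<le> x - x'" "\<bar>y\<bar> \<le> 2 * int k + 2 - x"
      | "\<bar>x - 2 * int k - 2\<bar> \<le> y" "\<bar>int k + 1 - x'\<bar> \<le> int k + 2 - y'"
      | "\<bar>x - int k\<bar> \<le> y + int k + 1" "\<bar>x' + 1\<bar> \<le> 1 - y'"
      using m[unfolded mem_region3_iff]
    proof (elim disjE, goal_cases)
    qed (use v k in \<open>(smt (verit))+\<close>)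
    then show "\<exists>(p, q)\<in>?T. cheb_between p (x, y) (x', y') q"
    proof cases
      case 1
      then have "cheb_between a (x, y) (x', y') c"
        unfolding a_def c_def using v by (intro cheb_between_vertical) linarith+
      then show ?thesis by simp
    next
      case 2
      then have "cheb_between b (x', y') (x, y) d"
        unfolding b_def d_def by (intro cheb_between_horizontal) linarith+
      then show ?thesis by (simp add: cheb_between_commute[of b])
    next
      case 3
      then have "cheb_between d (x, y) (x', y') c"
        unfolding c_def d_def using v by (intro cheb_between_vertical) linarith+
      then show ?thesis by simp
    next
      case 4
      then have "cheb_between a (x, y) (x', y') b"
        unfolding a_def b_def using v by (intro cheb_between_vertical) linarith+
      then show ?thesis by simp
    qed
  }
qed auto

section \<open>Obstructions in Helly graphs\<close>

lemma (in connected_helly_graph) contains_isometric_of_corners: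
  assumes X: "geodesic_metric X cheb" "finite X" "X \<noteq> {}"
    and V: "va \<in> verts G" "vb \<in> verts G" "vc \<in> verts G" "vd \<in> verts G"
    and le: "gdist G va vb \<le> ra + rb + cheb pa pb" "gdist G vb vc \<le> rb + rc + cheb pb pc"
      "gdist G vc vd \<le> rc + rd + cheb pc pd" "gdist G vd va \<le> rd + ra + cheb pd pa"
      "gdist G va vc \<le> ra + rc + cheb pa pc" "gdist G vb vd \<le> rb + rd + cheb pb pd"
    and between: "\<And>u w. u \<in> X \<Longrightarrow> w \<in> X \<Longrightarrow> \<exists>(p, q)\<in>T. cheb_between p u w q"
    and tight: "\<And>p q. (p, q) \<in> T \<Longrightarrow> \<exists>v r v' r'.
      (v, p, r) \<in> {(va, pa, ra), (vb, pb, rb), (vc, pc, rc), (vd, pd, rd)} \<and>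
      (v', q, r') \<in> {(va, pa, ra), (vb, pb, rb), (vc, pc, rc), (vd, pd, rd)} \<and>
      gdist G v v' = r + r' + cheb p q"
  shows "contains_isometric G (unit_graph X cheb)"
proof -
  define C where "C = {(va, pa, ra), (vb, pb, rb), (vc, pc, rc), (vd, pd, rd)}"
  have z: "gdist G va va = 0" "gdist G vb vb = 0" "gdist G vc vc = 0" "gdist G vd vd = 0"
    using zero_iff V by auto
  have s: "gdist G vb va = gdist G va vb" "gdist G vc vb = gdist G vb vc" "gdist G vd vc = gdist G vc vd"
    "gdist G va vd = gdist G vd va" "gdist G vc va = gdist G va vc" "gdist G vd vb = gdist G vb vd"
    using sym V by blast+
  have c: "cheb pb pa = cheb pa pb" "cheb pc pb = cheb pb pc" "cheb pd pc = cheb pc pd"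
    "cheb pa pd = cheb pd pa" "cheb pc pa = cheb pa pc" "cheb pd pb = cheb pb pd"
    by (rule cheb_sym)+
  have "\<forall>(v, p, r)\<in>C. v \<in> verts G" using V by (simp add: C_def)
  then have C1: "v \<in> verts G" if "(v, p, r) \<in> C" for v p r using that by blast
  have "\<forall>(v, p, r)\<in>C. \<forall>(v', p', r')\<in>C. gdist G v v' \<le> r + r' + cheb p p'"
    using le unfolding C_def by (simp add: z s c add.commute)
  then have C2: "gdist G v v' \<le> r + r' + cheb p p'"
    if "(v, p, r) \<in> C" "(v', p', r') \<in> C" for v p r v' p' r'
    using that by blast
  have "\<exists>(v, p, r)\<in>C. \<exists>(v', p', r')\<in>C.
      cheb p u + cheb u w + cheb w p' \<le> cheb p p' \<and> gdist G v v' = r + r' + cheb p p'"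
    if uw: "u \<in> X" "w \<in> X" for u w
  proof -
    obtain p q where pq: "(p, q) \<in> T" "cheb p u + cheb u w + cheb w q \<le> cheb p q"
      using between[OF uw] unfolding cheb_between_def by blast
    then obtain v r v' r' where "(v, p, r) \<in> C" "(v', q, r') \<in> C" "gdist G v v' = r + r' + cheb p q"
      using tight[folded C_def] by blast
    with pq(2) show ?thesis by blast
  qed
  with C1 C2 show ?thesis
    by (rule contains_isometric_unit_graph_of_constraints[OF X cheb_refl cheb_sym cheb_triangle])
qed

text \<open>Made for \<open>region1\<close> and \<open>region2\<close>, where every two points lie
  between opposite corners; the side inequalities may then be strict.\<close>

lemma (in connected_helly_graph) contains_isometric_of_opposite_corners:
  assumes X: "geodesic_metric X cheb" "finite X" "X \<noteq> {}"
    and V: "va \<in> verts G" "vb \<in> verts G" "vc \<in> verts G" "vd \<in> verts G"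
    and le: "gdist G va vb \<le> ra + rb + cheb pa pb" "gdist G vb vc \<le> rb + rc + cheb pb pc"
      "gdist G vc vd \<le> rc + rd + cheb pc pd" "gdist G vd va \<le> rd + ra + cheb pd pa"
    and eq: "gdist G va vc = ra + rc + cheb pa pc" "gdist G vb vd = rb + rd + cheb pb pd"
    and between: "\<And>u w. u \<in> X \<Longrightarrow> w \<in> X \<Longrightarrow>
      \<exists>(p, q)\<in>{(pa, pc), (pc, pa), (pb, pd), (pd, pb)}. cheb_between p u w q"
  shows "contains_isometric G (unit_graph X cheb)"
proof (rule contains_isometric_of_corners[OF X V le _ _ between])
  fix p q assume "(p, q) \<in> {(pa, pc), (pc, pa), (pb, pd), (pd, pb)}"
  then have "p = pa \<and> q = pc \<or> p = pc \<and> q = pa \<or> p = pb \<and> q = pd \<or> p = pd \<and> q = pb" by simp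
  moreover have "gdist G vc va = rc + ra + cheb pc pa" "gdist G vd vb = rd + rb + cheb pd pb"
    using eq sym[OF V(1,3)] sym[OF V(2,4)] cheb_sym[of pa pc] cheb_sym[of pb pd] by linarith+
  ultimately show "\<exists>v r v' r'. (v, p, r) \<in> {(va, pa, ra), (vb, pb, rb), (vc, pc, rc), (vd, pd, rd)} \<and>
      (v', q, r') \<in> {(va, pa, ra), (vb, pb, rb), (vc, pc, rc), (vd, pd, rd)} \<and>
      gdist G v v' = r + r' + cheb p q"
    using eq by (elim disjE conjE; hypsubst) blast+
qed (use eq in simp_all)

lemma (in connected_helly_graph) contains_isometric_of_exact_corners:
  assumes X: "geodesic_metric X cheb" "finite X" "X \<noteq> {}"
    and V: "va \<in> verts G" "vb \<in> verts G" "vc \<in> verts G" "vd \<in> verts G"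
    and eq: "gdist G va vb = ra + rb + cheb pa pb" "gdist G vb vc = rb + rc + cheb pb pc"
      "gdist G vc vd = rc + rd + cheb pc pd" "gdist G vd va = rd + ra + cheb pd pa"
      "gdist G va vc = ra + rc + cheb pa pc" "gdist G vb vd = rb + rd + cheb pb pd"
    and between: "\<And>u w. u \<in> X \<Longrightarrow> w \<in> X \<Longrightarrow>
      \<exists>(p, q)\<in>{(pa, pc), (pc, pa), (pb, pd), (pd, pb), (pa, pb), (pb, pa), (pb, pc), (pc, pb),
        (pc, pd), (pd, pc), (pd, pa), (pa, pd)}. cheb_between p u w q"
  shows "contains_isometric G (unit_graph X cheb)"
proof (rule contains_isometric_of_corners[OF X V _ _ _ _ _ _ between])
  fix p q assume "(p, q) \<in> {(pa, pc), (pc, pa), (pb, pd), (pd, pb), (pa, pb), (pb, pa), (pb, pc), (pc, pb),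
        (pc, pd), (pd, pc), (pd, pa), (pa, pd)}"
  then have "p = pa \<and> q = pc \<or> p = pc \<and> q = pa \<or> p = pb \<and> q = pd \<or> p = pd \<and> q = pb \<or>
    p = pa \<and> q = pb \<or> p = pb \<and> q = pa \<or> p = pb \<and> q = pc \<or> p = pc \<and> q = pb \<or>
    p = pc \<and> q = pd \<or> p = pd \<and> q = pc \<or> p = pd \<and> q = pa \<or> p = pa \<and> q = pd" by simp
  moreover have "gdist G vc va = rc + ra + cheb pc pa" "gdist G vd vb = rd + rb + cheb pd pb"
    "gdist G vb va = rb + ra + cheb pb pa" "gdist G vc vb = rc + rb + cheb pc pb"
    "gdist G vd vc = rd + rc + cheb pd pc" "gdist G va vd = ra + rd + cheb pa pd"
    using eq sym[OF V(1,3)] sym[OF V(2,4)] sym[OF V(1,2)] sym[OF V(2,3)] sym[OF V(3,4)] sym[OF V(4,1)]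
      cheb_sym[of pa pc] cheb_sym[of pb pd] cheb_sym[of pa pb] cheb_sym[of pb pc] cheb_sym[of pc pd]
      cheb_sym[of pd pa] by linarith+
  ultimately show "\<exists>v r v' r'. (v, p, r) \<in> {(va, pa, ra), (vb, pb, rb), (vc, pc, rc), (vd, pd, rd)} \<and>
      (v', q, r') \<in> {(va, pa, ra), (vb, pb, rb), (vc, pc, rc), (vd, pd, rd)} \<and>
      gdist G v v' = r + r' + cheb p q"
    using eq by (elim disjE conjE; hypsubst) blast+
qed (use eq in simp_all)

text \<open>
  The four tails join the given vertices, at distances \<open>ab\<close>, \<open>bc\<close>, \<open>cd\<close>, \<open>da\<close>, \<open>ac\<close>, \<open>bd\<close>, to the
  corners of a region with sides \<open>s\<close> and diagonals \<open>p\<close> and \<open>q\<close>. They are determined by \<open>S = \<alpha> + \<beta>\<close>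
  and \<open>D = \<beta> - \<alpha>\<close>, which range over integer intervals and must have the same parity.
\<close>

lemma tails_exist:
  fixes ab bc cd da ac bd p q s S D :: int
  assumes tri: "bd \<le> ab + da" "ac \<le> ab + bc" "bd \<le> bc + cd" "ac \<le> cd + da"
    and pq: "2 * s - 1 \<le> p" "2 * s - 1 \<le> q"
    and S: "ab - s \<le> S" "S \<le> ac + bd - p - q - cd + s"
    and D: "bc - ac + p - s \<le> D" "D \<le> bd - q - da + s"
    and even: "even (S + D)"
  shows "\<exists>(\<alpha> :: nat) (\<beta> :: nat) (\<gamma> :: nat) (\<epsilon> :: nat). \<alpha> + \<beta> = S \<and> \<beta> - \<alpha> = D \<and> ac = \<alpha> + \<gamma> + p \<and> bd = \<beta> + \<epsilon> + q \<and>
    ab \<le> \<alpha> + \<beta> + s \<and> bc \<le> \<beta> + \<gamma> + s \<and> cd \<le> \<gamma> + \<epsilon> + s \<and> da \<le> \<epsilon> + \<alpha> + s"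
proof -
  obtain b where b: "S + D = 2 * b" using even by blast
  define a where "a = S - b"
  define c where "c = ac - p - a"
  define e where "e = bd - q - b"
  \<comment> \<open>For instance \<open>2 * a = S - D\<close> is at least
    \<open>ab + da - bd + q - 2 * s\<close>, hence at least -1, and integrality gives 0. So a
    diagonal may fall short of two sides by one, as happens in \<open>H2\<close> and
    \<open>H3\<close>.\<close>
  have "0 \<le> a" "0 \<le> b" "0 \<le> c" "0 \<le> e"
    using tri pq S D b unfolding a_def c_def e_def by linarith+
  then show ?thesis
    using S D b unfolding a_def c_def e_def
    by (intro exI[of _ "nat (S - b)"] exI[of _ "nat b"] exI[of _ "nat (ac - p - (S - b))"]
        exI[of _ "nat (bd - q - b)"]) auto
qed

context connected_helly_graph
begin

text \<open>The diagonals \<open>2 * k + 2\<close> and \<open>2 * k + 1\<close> exceed two sides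
  \<open>k + 1\<close> by exactly \<open>2 * k + 1\<close>, so \<open>gap\<close> says that the
  intervals for \<open>S\<close> and \<open>D\<close> are nonempty.\<close>

lemma contains_H2:
  assumes V: "a \<in> verts G" "b \<in> verts G" "c \<in> verts G" "d \<in> verts G"
    and gap: "gdist G a b + gdist G c d + 2 * k + 1 \<le> gdist G a c + gdist G b d"
      "gdist G b c + gdist G d a + 2 * k + 1 \<le> gdist G a c + gdist G b d"
  shows "contains_isometric G (H2 k k)"
proof -
  have copy: "contains_isometric G (H2 k k)"
    if V: "a \<in> verts G" "b \<in> verts G" "c \<in> verts G" "d \<in> verts G"
      and S: "int (gdist G a b) - (int k + 1) \<le> S"
        "S \<le> int (gdist G a c) + gdist G b d - (2 * int k + 2) - (2 * int k + 1) - gdist G c d + (int k + 1)"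
      and D: "int (gdist G b c) - gdist G a c + (2 * int k + 2) - (int k + 1) \<le> D"
        "D \<le> int (gdist G b d) - (2 * int k + 1) - gdist G d a + (int k + 1)"
      and even: "even (S + D)" for a b c d S D
  proof -
    have tri: "int (gdist G b d) \<le> int (gdist G a b) + gdist G d a"
      "int (gdist G a c) \<le> int (gdist G a b) + gdist G b c"
      "int (gdist G b d) \<le> int (gdist G b c) + gdist G c d"
      "int (gdist G a c) \<le> int (gdist G c d) + gdist G d a"
      using triangle[OF V(2,1,4)] triangle[OF V(1,2,3)] triangle[OF V(2,3,4)] triangle[OF V(1,4,3)]
        sym[OF V(1,2)] sym[OF V(1,4)] sym[OF V(3,4)] by linarith+
    have "\<exists>(\<alpha> :: nat) (\<beta> :: nat) (\<gamma> :: nat) (\<epsilon> :: nat). \<alpha> + \<beta> = S \<and> \<beta> - \<alpha> = D \<and>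
      int (gdist G a c) = \<alpha> + \<gamma> + (2 * int k + 2) \<and> int (gdist G b d) = \<beta> + \<epsilon> + (2 * int k + 1) \<and>
      int (gdist G a b) \<le> \<alpha> + \<beta> + (int k + 1) \<and> int (gdist G b c) \<le> \<beta> + \<gamma> + (int k + 1) \<and>
      int (gdist G c d) \<le> \<gamma> + \<epsilon> + (int k + 1) \<and> int (gdist G d a) \<le> \<epsilon> + \<alpha> + (int k + 1)"
      by (rule tails_exist[OF tri _ _ S D even]) simp_all
    then obtain \<alpha> \<beta> \<gamma> \<epsilon> :: nat where t: "int (gdist G a c) = \<alpha> + \<gamma> + (2 * int k + 2)"
      "int (gdist G b d) = \<beta> + \<epsilon> + (2 * int k + 1)"
      "int (gdist G a b) \<le> \<alpha> + \<beta> + (int k + 1)" "int (gdist G b c) \<le> \<beta> + \<gamma> + (int k + 1)"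
      "int (gdist G c d) \<le> \<gamma> + \<epsilon> + (int k + 1)" "int (gdist G d a) \<le> \<epsilon> + \<alpha> + (int k + 1)"
      unfolding of_nat_add by blast
    let ?a = "(-1, 0) :: int \<times> int" and ?b = "(int k, - int k)"
      and ?c = "(2 * int k + 1, 1)" and ?d = "(int k, int k + 1)"
    have ch: "int (cheb ?a ?b) = int k + 1" "int (cheb ?b ?c) = int k + 1" "int (cheb ?c ?d) = int k + 1"
      "int (cheb ?d ?a) = int k + 1" "int (cheb ?a ?c) = 2 * int k + 2" "int (cheb ?b ?d) = 2 * int k + 1"
      unfolding int_cheb by simp_all
    have ac: "gdist G a c = \<alpha> + \<gamma> + cheb ?a ?c" and bd: "gdist G b d = \<beta> + \<epsilon> + cheb ?b ?d"
      using t(1,2) ch by linarith+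
    show ?thesis
      unfolding H_eq_unit_graph
    proof (rule contains_isometric_of_opposite_corners[OF geodesic_metric_region2 finite_region(2) _ V
          _ _ _ _ ac bd region2_between])
      show "region2 k \<noteq> {}" by (auto simp: region2_def)
      show "gdist G a b \<le> \<alpha> + \<beta> + cheb ?a ?b" "gdist G b c \<le> \<beta> + \<gamma> + cheb ?b ?c"
        "gdist G c d \<le> \<gamma> + \<epsilon> + cheb ?c ?d" "gdist G d a \<le> \<epsilon> + \<alpha> + cheb ?d ?a"
        using t ch by linarith+
    qed
  qed
  define S0 where "S0 = int (gdist G a b) - (int k + 1)"
  define D0 where "D0 = int (gdist G b c) - gdist G a c + (int k + 1)"
  have s: "gdist G c a = gdist G a c" "gdist G b d = gdist G d b" by (rule sym; fact)+
  \<comment> \<open>\<open>S0\<close> and \<open>D0\<close> are the least admissible values; a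
    strict inequality in \<open>gap\<close> allows raising one of them by 1 to correct the
    parity.\<close>
  consider "even (S0 + D0)"
    | "odd (S0 + D0)" "gdist G a b + gdist G c d + 2 * k + 1 < gdist G a c + gdist G b d"
    | "odd (S0 + D0)" "gdist G b c + gdist G d a + 2 * k + 1 < gdist G a c + gdist G b d"
    | "odd (S0 + D0)" "gdist G a b + gdist G c d = gdist G b c + gdist G d a"
      "gdist G a b + gdist G c d + 2 * k + 1 = gdist G a c + gdist G b d"
    using gap by linarith
  then show ?thesis
  proof cases
    case 1
    show ?thesis by (rule copy[OF V, of S0 D0]) (use gap 1 in \<open>auto simp: S0_def D0_def\<close>)
  next
    case 2
    show ?thesis by (rule copy[OF V, of "S0 + 1" D0]) (use gap 2 in \<open>auto simp: S0_def D0_def\<close>)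
  next
    case 3
    show ?thesis by (rule copy[OF V, of S0 "D0 + 1"]) (use gap 3 in \<open>auto simp: S0_def D0_def\<close>)
  next
    case 4
    \<comment> \<open>Exchanging the roles of the two diagonals changes the parity.\<close>
    define D1 where "D1 = int (gdist G c d) - gdist G b d + (int k + 1)"
    define S1 where "S1 = int (gdist G b c) - (int k + 1)"
    have "int (gdist G a b) + gdist G c d + 2 * int k + 1 = int (gdist G a c) + gdist G b d"
      using 4(3) by linarith
    then have "S0 + D0 + (S1 + D1) = 2 * (gdist G b c - int k) - 1"
      unfolding S0_def D0_def S1_def D1_def by (simp add: algebra_simps)
    then have even: "even (S1 + D1)" using 4(1) by presburger
    show ?thesis
      by (rule copy[OF V(2,3,4,1), of S1 D1]) (use gap even s in \<open>auto simp: S1_def D1_def\<close>)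
  qed
qed

text \<open>From \<open>H1 k k\<close> to \<open>H3 (k - 1) (k - 1)\<close> all sides and both
  diagonals between the corners grow by one. The excess stays \<open>2 * k\<close>, but the parity
  of \<open>S + D\<close> changes.\<close>

lemma contains_H1_or_H3:
  assumes V: "a \<in> verts G" "b \<in> verts G" "c \<in> verts G" "d \<in> verts G" and "1 \<le> k"
    and gap: "gdist G a b + gdist G c d + 2 * k \<le> gdist G a c + gdist G b d"
      "gdist G b c + gdist G d a + 2 * k \<le> gdist G a c + gdist G b d"
  shows "contains_isometric G (H1 k k) \<or> contains_isometric G (H3 (k - 1) (k - 1))"
proof -
  have tri: "int (gdist G b d) \<le> int (gdist G a b) + gdist G d a"
    "int (gdist G a c) \<le> int (gdist G a b) + gdist G b c"
    "int (gdist G b d) \<le> int (gdist G b c) + gdist G c d"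
    "int (gdist G a c) \<le> int (gdist G c d) + gdist G d a"
    using triangle[OF V(2,1,4)] triangle[OF V(1,2,3)] triangle[OF V(2,3,4)] triangle[OF V(1,4,3)]
      sym[OF V(1,2)] sym[OF V(1,4)] sym[OF V(3,4)] by linarith+
  have copy1: "contains_isometric G (H1 k k)"
    if S: "int (gdist G a b) - int k \<le> S"
        "S \<le> int (gdist G a c) + gdist G b d - 2 * int k - 2 * int k - gdist G c d + int k"
      and D: "int (gdist G b c) - gdist G a c + 2 * int k - int k \<le> D"
        "D \<le> int (gdist G b d) - 2 * int k - gdist G d a + int k"
      and even: "even (S + D)" for S D
  proof -
    have "\<exists>(\<alpha> :: nat) (\<beta> :: nat) (\<gamma> :: nat) (\<epsilon> :: nat). \<alpha> + \<beta> = S \<and> \<beta> - \<alpha> = D \<and>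
      int (gdist G a c) = \<alpha> + \<gamma> + 2 * int k \<and> int (gdist G b d) = \<beta> + \<epsilon> + 2 * int k \<and>
      int (gdist G a b) \<le> \<alpha> + \<beta> + int k \<and> int (gdist G b c) \<le> \<beta> + \<gamma> + int k \<and>
      int (gdist G c d) \<le> \<gamma> + \<epsilon> + int k \<and> int (gdist G d a) \<le> \<epsilon> + \<alpha> + int k"
      by (rule tails_exist[OF tri _ _ S D even]) simp_all
    then obtain \<alpha> \<beta> \<gamma> \<epsilon> :: nat where t: "int (gdist G a c) = \<alpha> + \<gamma> + 2 * int k"
      "int (gdist G b d) = \<beta> + \<epsilon> + 2 * int k"
      "int (gdist G a b) \<le> \<alpha> + \<beta> + int k" "int (gdist G b c) \<le> \<beta> + \<gamma> + int k"
      "int (gdist G c d) \<le> \<gamma> + \<epsilon> + int k" "int (gdist G d a) \<le> \<epsilon> + \<alpha> + int k"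
      unfolding of_nat_add by blast
    let ?a = "(0, 0) :: int \<times> int" and ?b = "(int k, - int k)"
      and ?c = "(2 * int k, 0 :: int)" and ?d = "(int k, int k)"
    have ch: "int (cheb ?a ?b) = int k" "int (cheb ?b ?c) = int k" "int (cheb ?c ?d) = int k"
      "int (cheb ?d ?a) = int k" "int (cheb ?a ?c) = 2 * int k" "int (cheb ?b ?d) = 2 * int k"
      unfolding int_cheb by simp_all
    have ac: "gdist G a c = \<alpha> + \<gamma> + cheb ?a ?c" and bd: "gdist G b d = \<beta> + \<epsilon> + cheb ?b ?d"
      using t(1,2) ch by linarith+
    show ?thesis
      unfolding H_eq_unit_graph
    proof (rule contains_isometric_of_opposite_corners[OF geodesic_metric_region1 finite_region(1) _ V
          _ _ _ _ ac bd region1_between])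
      show "region1 k \<noteq> {}" by (auto simp: region1_def intro!: exI[of _ 0])
      show "gdist G a b \<le> \<alpha> + \<beta> + cheb ?a ?b" "gdist G b c \<le> \<beta> + \<gamma> + cheb ?b ?c"
        "gdist G c d \<le> \<gamma> + \<epsilon> + cheb ?c ?d" "gdist G d a \<le> \<epsilon> + \<alpha> + cheb ?d ?a"
        using t ch by linarith+
    qed
  qed
  define S0 where "S0 = int (gdist G a b) - int k"
  define D0 where "D0 = int (gdist G b c) - gdist G a c + int k"
  consider "even (S0 + D0)"
    | "odd (S0 + D0)" "gdist G a b + gdist G c d + 2 * k < gdist G a c + gdist G b d"
    | "odd (S0 + D0)" "gdist G b c + gdist G d a + 2 * k < gdist G a c + gdist G b d"
    | "odd (S0 + D0)" "gdist G a b + gdist G c d + 2 * k = gdist G a c + gdist G b d"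
      "gdist G b c + gdist G d a + 2 * k = gdist G a c + gdist G b d"
    using gap by linarith
  then show ?thesis
  proof cases
    case 1
    have "contains_isometric G (H1 k k)" by (rule copy1[of S0 D0]) (use gap 1 in \<open>auto simp: S0_def D0_def\<close>)
    then show ?thesis ..
  next
    case 2
    have "contains_isometric G (H1 k k)" by (rule copy1[of "S0 + 1" D0]) (use gap 2 in \<open>auto simp: S0_def D0_def\<close>)
    then show ?thesis ..
  next
    case 3
    have "contains_isometric G (H1 k k)" by (rule copy1[of S0 "D0 + 1"]) (use gap 3 in \<open>auto simp: S0_def D0_def\<close>)
    then show ?thesis ..
  next
    case 4
    \<comment> \<open>The interval for \<open>S\<close> and the one for \<open>D\<close> are single points of different parity. With diagonals
      \<open>2 * k + 1\<close> and sides \<open>k + 1\<close> they still are, and \<open>S\<close> drops by one.\<close>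
    define l where "l = k - 1"
    have k: "int k = int l + 1" using \<open>1 \<le> k\<close> by (simp add: l_def)
    have eq: "int (gdist G a b) + gdist G c d + 2 * int k = int (gdist G a c) + gdist G b d"
      "int (gdist G b c) + gdist G d a + 2 * int k = int (gdist G a c) + gdist G b d"
      using 4(2,3) by linarith+
    have pq: "2 * (int l + 2) - 1 \<le> 2 * int l + 3" by simp
    have "\<exists>(\<alpha> :: nat) (\<beta> :: nat) (\<gamma> :: nat) (\<epsilon> :: nat). \<alpha> + \<beta> = S0 - 1 \<and> \<beta> - \<alpha> = D0 \<and>
      int (gdist G a c) = \<alpha> + \<gamma> + (2 * int l + 3) \<and> int (gdist G b d) = \<beta> + \<epsilon> + (2 * int l + 3) \<and>
      int (gdist G a b) \<le> \<alpha> + \<beta> + (int l + 2) \<and> int (gdist G b c) \<le> \<beta> + \<gamma> + (int l + 2) \<and>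
      int (gdist G c d) \<le> \<gamma> + \<epsilon> + (int l + 2) \<and> int (gdist G d a) \<le> \<epsilon> + \<alpha> + (int l + 2)"
      by (rule tails_exist[OF tri pq pq]) (use eq k 4(1) in \<open>auto simp: S0_def D0_def\<close>)
    then obtain \<alpha> \<beta> \<gamma> \<epsilon> :: nat where S: "int \<alpha> + int \<beta> = S0 - 1" "int \<beta> - int \<alpha> = D0"
      and ac: "int (gdist G a c) = \<alpha> + \<gamma> + (2 * int l + 3)" and bd: "int (gdist G b d) = \<beta> + \<epsilon> + (2 * int l + 3)"
      unfolding of_nat_add by blast
    \<comment> \<open>Both inequalities of \<open>gap\<close> are equalities here, so the tails make
      all four sides exact, as \<open>region3\<close> requires.\<close>
    have t: "int (gdist G a b) = \<alpha> + \<beta> + (int l + 2)" "int (gdist G b c) = \<beta> + \<gamma> + (int l + 2)"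
      "int (gdist G c d) = \<gamma> + \<epsilon> + (int l + 2)" "int (gdist G d a) = \<epsilon> + \<alpha> + (int l + 2)"
      using S ac bd eq k unfolding S0_def D0_def by linarith+
    let ?a = "(int l, - int l - 1)" and ?b = "(-1, 1) :: int \<times> int"
      and ?c = "(int l + 1, int l + 2)" and ?d = "(2 * int l + 2, 0 :: int)"
    have ch: "int (cheb ?a ?b) = int l + 2" "int (cheb ?b ?c) = int l + 2" "int (cheb ?c ?d) = int l + 2"
      "int (cheb ?d ?a) = int l + 2" "int (cheb ?a ?c) = 2 * int l + 3" "int (cheb ?b ?d) = 2 * int l + 3"
      unfolding int_cheb by simp_all
    have exact: "gdist G a b = \<alpha> + \<beta> + cheb ?a ?b" "gdist G b c = \<beta> + \<gamma> + cheb ?b ?c"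
      "gdist G c d = \<gamma> + \<epsilon> + cheb ?c ?d" "gdist G d a = \<epsilon> + \<alpha> + cheb ?d ?a"
      "gdist G a c = \<alpha> + \<gamma> + cheb ?a ?c" "gdist G b d = \<beta> + \<epsilon> + cheb ?b ?d"
      using t ac bd ch by linarith+
    have "region3 l \<noteq> {}" by (auto simp: region3_def)
    then have "contains_isometric G (H3 l l)"
      unfolding H_eq_unit_graph
      by (rule contains_isometric_of_exact_corners[OF geodesic_metric_region3 finite_region(3) _ V
          exact region3_between])
    then show ?thesis by (simp add: l_def)
  qed
qed

end

section \<open>Hyperbolicity of graphs containing an obstruction\<close>

lemma (in connected_graph) corners_gap:
  assumes "geodesic_metric X cheb" "contains_isometric G (unit_graph X cheb)"
    and "{a, b, c, d} \<subseteq> X" and "hb G \<le> real n / 2"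
  shows "cheb a c + cheb b d \<le> max (cheb a b + cheb c d) (cheb a d + cheb c b) + n"
proof -
  obtain \<phi> where phi: "\<phi> ` X \<subseteq> verts G" "\<forall>u\<in>X. \<forall>v\<in>X. gdist G (\<phi> u) (\<phi> v) = cheb u v"
    using contains_isometric_unit_graphD[OF assms(1,2)] by blast
  have X: "a \<in> X" "b \<in> X" "c \<in> X" "d \<in> X" using assms(3) by auto
  then have "\<phi> a \<in> verts G" "\<phi> b \<in> verts G" "\<phi> c \<in> verts G" "\<phi> d \<in> verts G" using phi(1) by auto
  with assms(4) have "gdist G (\<phi> a) (\<phi> c) + gdist G (\<phi> b) (\<phi> d) \<le>
      max (gdist G (\<phi> a) (\<phi> b) + gdist G (\<phi> c) (\<phi> d)) (gdist G (\<phi> a) (\<phi> d) + gdist G (\<phi> c) (\<phi> b)) + n"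
    unfolding hb_le_iff by blast
  then show ?thesis using phi(2) X by simp
qed

text \<open>The diagonals exceed two opposite sides by \<open>2 * k + 1\<close>, one more than the
  bound allows. The same count gives \<open>2 * k\<close> against \<open>2 * k - 1\<close> for
  \<open>H1\<close>, and \<open>2 * k + 2\<close> against \<open>2 * k + 1\<close> for
  \<open>H3\<close>.\<close>

lemma (in connected_graph) hb_gt_of_contains_H2:
  assumes "contains_isometric G (H2 k k)"
  shows "\<not> hb G \<le> real (2 * k) / 2"
proof
  let ?a = "(-1, 0) :: int \<times> int" and ?b = "(int k, - int k)"
    and ?c = "(2 * int k + 1, 1)" and ?d = "(int k, int k + 1)"
  assume hb: "hb G \<le> real (2 * k) / 2"
  have sub: "{?a, ?b, ?c, ?d} \<subseteq> region2 k" by (auto simp: mem_region2_iff)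
  from corners_gap[OF geodesic_metric_region2 assms[unfolded H_eq_unit_graph] sub hb]
  have "cheb ?a ?c + cheb ?b ?d \<le> max (cheb ?a ?b + cheb ?c ?d) (cheb ?a ?d + cheb ?c ?b) + 2 * k" .
  moreover have "int (cheb ?a ?c) = 2 * int k + 2" "int (cheb ?b ?d) = 2 * int k + 1" "int (cheb ?a ?b) = int k + 1" "int (cheb ?c ?d) = int k + 1"
    "int (cheb ?a ?d) = int k + 1" "int (cheb ?c ?b) = int k + 1"
    unfolding int_cheb by simp_all
  ultimately show False by linarith
qed

text \<open>For \<open>k = 0\<close> the region is a single point and the truncated bound would be
  0, hence the assumption \<open>1 \<le> k\<close>.\<close>

lemma (in connected_graph) hb_gt_of_contains_H1:
  assumes "contains_isometric G (H1 k k)" "1 \<le> k"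
  shows "\<not> hb G \<le> real (2 * k - 1) / 2"
proof
  let ?a = "(0, 0) :: int \<times> int" and ?b = "(int k, - int k)"
    and ?c = "(2 * int k, 0) :: int \<times> int" and ?d = "(int k, int k)"
  assume hb: "hb G \<le> real (2 * k - 1) / 2"
  have sub: "{?a, ?b, ?c, ?d} \<subseteq> region1 k" by (auto simp: mem_region1_iff)
  from corners_gap[OF geodesic_metric_region1 assms(1)[unfolded H_eq_unit_graph] sub hb]
  have "cheb ?a ?c + cheb ?b ?d \<le> max (cheb ?a ?b + cheb ?c ?d) (cheb ?a ?d + cheb ?c ?b) + (2 * k - 1)" .
  moreover have "int (cheb ?a ?c) = 2 * int k" "int (cheb ?b ?d) = 2 * int k" "int (cheb ?a ?b) = int k" "int (cheb ?c ?d) = int k"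
    "int (cheb ?a ?d) = int k" "int (cheb ?c ?b) = int k"
    unfolding int_cheb by simp_all
  ultimately show False using assms(2) by linarith
qed

lemma (in connected_graph) hb_gt_of_contains_H3:
  assumes "contains_isometric G (H3 k k)"
  shows "\<not> hb G \<le> real (2 * k + 1) / 2"
proof
  let ?a = "(int k, - int k - 1)" and ?b = "(-1, 1) :: int \<times> int"
    and ?c = "(int k + 1, int k + 2)" and ?d = "(2 * int k + 2, 0) :: int \<times> int"
  assume hb: "hb G \<le> real (2 * k + 1) / 2"
  have sub: "{?a, ?b, ?c, ?d} \<subseteq> region3 k" by (auto simp: mem_region3_iff)
  from corners_gap[OF geodesic_metric_region3 assms[unfolded H_eq_unit_graph] sub hb]
  have "cheb ?a ?c + cheb ?b ?d \<le> max (cheb ?a ?b + cheb ?c ?d) (cheb ?a ?d + cheb ?c ?b) + (2 * k + 1)" .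
  moreover have "int (cheb ?a ?c) = 2 * int k + 3" "int (cheb ?b ?d) = 2 * int k + 3" "int (cheb ?a ?b) = int k + 2" "int (cheb ?c ?d) = int k + 2"
    "int (cheb ?a ?d) = int k + 2" "int (cheb ?c ?b) = int k + 2"
    unfolding int_cheb by simp_all
  ultimately show False by linarith
qed

context connected_helly_graph
begin

lemma hb_gt_quadruple:
  assumes "\<not> hb G \<le> real n / 2"
  obtains a b c d where "a \<in> verts G" "b \<in> verts G" "c \<in> verts G" "d \<in> verts G"
    "gdist G a b + gdist G c d + n < gdist G a c + gdist G b d"
    "gdist G b c + gdist G d a + n < gdist G a c + gdist G b d"
proof -
  obtain a c b d where V: "a \<in> verts G" "c \<in> verts G" "b \<in> verts G" "d \<in> verts G"
    and "\<not> gdist G a c + gdist G b d \<le> max (gdist G a b + gdist G c d) (gdist G a d + gdist G c b) + n"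
    using assms unfolding hb_le_iff by blast
  moreover have "gdist G a d = gdist G d a" "gdist G c b = gdist G b c"
    using sym[OF V(1,4)] sym[OF V(2,3)] by simp_all
  ultimately show ?thesis using that[OF V(1,3,2,4)] by simp
qed

lemma hb_le_iff_no_H2:
  "hb G \<le> real (2 * k) / 2 \<longleftrightarrow> \<not> contains_isometric G (H2 k k)"
proof
  show "\<not> contains_isometric G (H2 k k)" if "hb G \<le> real (2 * k) / 2"
    using that hb_gt_of_contains_H2 by blast
  show "hb G \<le> real (2 * k) / 2" if no: "\<not> contains_isometric G (H2 k k)"
  proof (rule ccontr)
    assume "\<not> hb G \<le> real (2 * k) / 2"
    then obtain a b c d where V: "a \<in> verts G" "b \<in> verts G" "c \<in> verts G" "d \<in> verts G"
      and "gdist G a b + gdist G c d + 2 * k < gdist G a c + gdist G b d"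
        "gdist G b c + gdist G d a + 2 * k < gdist G a c + gdist G b d"
      by (rule hb_gt_quadruple)
    then have "contains_isometric G (H2 k k)" by (intro contains_H2[OF V]) simp_all
    with no show False ..
  qed
qed

text \<open>Here \<open>k\<close> stands for \<delta> + 1/2, so \<open>2 * k - 1\<close> is twice
  \<delta> and \<open>k - 1\<close> is \<delta> - 1/2.\<close>

lemma hb_le_iff_no_H1_H3:
  assumes "1 \<le> k"
  shows "hb G \<le> real (2 * k - 1) / 2 \<longleftrightarrow>
    \<not> contains_isometric G (H1 k k) \<and> \<not> contains_isometric G (H3 (k - 1) (k - 1))"
proof
  have "2 * (k - 1) + 1 = 2 * k - 1" using assms by simp
  then show "\<not> contains_isometric G (H1 k k) \<and> \<not> contains_isometric G (H3 (k - 1) (k - 1))"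
    if "hb G \<le> real (2 * k - 1) / 2"
    using that hb_gt_of_contains_H1[OF _ assms] hb_gt_of_contains_H3[of "k - 1"] by metis
  show "hb G \<le> real (2 * k - 1) / 2"
    if no: "\<not> contains_isometric G (H1 k k) \<and> \<not> contains_isometric G (H3 (k - 1) (k - 1))"
  proof (rule ccontr)
    assume "\<not> hb G \<le> real (2 * k - 1) / 2"
    then obtain a b c d where V: "a \<in> verts G" "b \<in> verts G" "c \<in> verts G" "d \<in> verts G"
      and "gdist G a b + gdist G c d + (2 * k - 1) < gdist G a c + gdist G b d"
        "gdist G b c + gdist G d a + (2 * k - 1) < gdist G a c + gdist G b d"
      by (rule hb_gt_quadruple)
    then have "contains_isometric G (H1 k k) \<or> contains_isometric G (H3 (k - 1) (k - 1))"
      using assms by (intro contains_H1_or_H3[OF V]) simp_all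
    with no show False by blast
  qed
qed

end

theorem theorem1:
  fixes G :: "('a, 'b) pre_digraph" and H :: "('c, 'd) pre_digraph" and \<delta> :: real
  assumes "conn_graph G"
    and "is_injective_hull G H"
    and "\<delta> \<ge> 0"
    and "\<delta> \<in> \<int> \<or> \<delta> - 1/2 \<in> \<int>"
  shows "hb G \<le> \<delta> \<longleftrightarrow>
    (\<delta> \<in> \<int> \<longrightarrow>
       \<not> contains_isometric H (H2 (nat \<lfloor>\<delta>\<rfloor>) (nat \<lfloor>\<delta>\<rfloor>))) \<and>
    (\<delta> - 1/2 \<in> \<int> \<longrightarrow>
       \<not> contains_isometric H (H1 (nat \<lfloor>\<delta> + 1/2\<rfloor>) (nat \<lfloor>\<delta> + 1/2\<rfloor>)) \<and>
       \<not> contains_isometric H (H3 (nat \<lfloor>\<delta> - 1/2\<rfloor>) (nat \<lfloor>\<delta> - 1/2\<rfloor>)))"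
proof -
  interpret H: connected_helly_graph H
    using assms(2) unfolding is_injective_hull_def helly_graph_def connected_helly_graph_def
      connected_helly_graph_axioms_def connected_graph_iff by blast
  \<comment> \<open>Exactly one of the two implications in the conclusion has a true premise; the
    other is vacuous.\<close>
  have not_both: "\<not> (\<delta> \<in> \<int> \<and> \<delta> - 1/2 \<in> \<int>)"
  proof
    assume "\<delta> \<in> \<int> \<and> \<delta> - 1/2 \<in> \<int>"
    then have "\<delta> - (\<delta> - 1/2) \<in> \<int>" by (blast intro: Ints_diff[of \<delta> "\<delta> - 1/2"])
    then obtain z where "\<delta> - (\<delta> - 1/2) = real_of_int z" by (rule Ints_cases)
    then have "real_of_int (2 * z) = real_of_int 1" by simp
    then have "2 * z = 1" by (simp only: of_int_eq_iff)
    then show False by presburger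
  qed
  from assms(4) show ?thesis
  proof
    assume int: "\<delta> \<in> \<int>"
    define k where "k = nat \<lfloor>\<delta>\<rfloor>"
    from int obtain z where "\<delta> = real_of_int z" by (rule Ints_cases)
    then have "\<delta> = real (2 * k) / 2" using assms(3) by (simp add: k_def)
    then show ?thesis
      using hb_injective_hull_le_iff[OF assms(1,2), of "2 * k"] H.hb_le_iff_no_H2[of k] int not_both
      unfolding k_def[symmetric] by auto
  next
    assume half: "\<delta> - 1/2 \<in> \<int>"
    then obtain z where z: "\<delta> - 1/2 = real_of_int z" by (rule Ints_cases)
    then have "-1 < real_of_int z" using assms(3) by linarith
    then have "0 \<le> z" by linarith
    define k where "k = nat \<lfloor>\<delta> + 1/2\<rfloor>"
    have "\<delta> + 1/2 = real_of_int (z + 1)" using z by simp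
    then have k: "k = nat (z + 1)" unfolding k_def by (simp only: floor_of_int)
    then have k1: "1 \<le> k" and km: "nat \<lfloor>\<delta> - 1/2\<rfloor> = k - 1" using \<open>0 \<le> z\<close> z by auto
    have "\<delta> = real (2 * k - 1) / 2" using k z \<open>0 \<le> z\<close> by (simp add: of_nat_diff)
    then show ?thesis
      using hb_injective_hull_le_iff[OF assms(1,2), of "2 * k - 1"] H.hb_le_iff_no_H1_H3[OF k1] half not_both
      unfolding k_def[symmetric] km by auto
  qed
qed

end
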